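(* Let $\alpha>2$, $\rho,r_{\mathrm{tr}},\beta>0$ and $\epsilon\in(0,1)$ be fixed. Consider spatial multiplexing with either MRC or ZF receivers, with $N$ antennas per node and $M=M(N)\in\{1,\dots,N\}$ data streams per transmitter, and let $\mathrm{c}(\epsilon)$ be the transmission capacity. Then linear scaling in $N$ is the best possible and is achieved with $M$ proportional to $N$; that is: (i) if $M=\kappa N$ with $0<\kappa<1$ (over $N$ with $\kappa N$ an integer) and $\beta<\bar\beta$, where $\bar\beta=\frac{1}{\kappa(r_{\mathrm{tr}}^{\alpha}/\rho+1)}$ for MRC and $\bar\beta=\frac{\rho}{r_{\mathrm{tr}}^{\alpha}}\left(\frac1\kappa-1\right)$ for ZF, then $\mathrm{c}(\epsilon)=\Theta(N)$ as $N\to\infty$; (ii) for every choice of $M=M(N)\le N$, $\mathrm{c}(\epsilon)=O(N)$ as $N\to\infty$; (iii) if $M$ varies sub-linearly with $N$, i.e. $M(N)=o(N)$, then the transmission capacity also scales sub-linearly, i.e. $\mathrm{c}(\epsilon)=o(N)$.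
   Context: Model: for $\mu>0$, the SINR of a data stream is distributed as $$\gamma_\mu=\frac{W}{Y+\sum_{\ell}|X_\ell|^{-\alpha}\Psi_{\ell 0}+1},$$ where $\{X_\ell\}$ is a homogeneous Poisson point process on $\mathbb{R}^2$ of intensity $\mu$, $\Psi_{\ell 0}$ are i.i.d. $\mathrm{Gamma}\left(M,\frac{\rho}{M}\right)$, and: for MRC, $W\sim\mathrm{Gamma}\left(N,\frac{\rho}{Mr_{\mathrm{tr}}^{\alpha}}\right)$ and $Y\sim\mathrm{Gamma}\left(M-1,\frac{\rho}{Mr_{\mathrm{tr}}^{\alpha}}\right)$ ($Y\equiv0$ if $M=1$); for ZF, $W\sim\mathrm{Gamma}\left(N-M+1,\frac{\rho}{Mr_{\mathrm{tr}}^{\alpha}}\right)$ and $Y\equiv 0$. All variables are mutually independent, and $\mathrm{Gamma}(v,\vartheta)$ has shape $v$ and scale $\vartheta$. Let $\mathrm{F}(\beta;\mu)=\Pr(\gamma_\mu\le\beta)$. The transmission capacity is $\mathrm{c}(\epsilon)=M\,\mu(\epsilon)(1-\epsilon)$, where $\mu(\epsilon)$ is the solution $\mu$ of $\epsilon=\mathrm{F}(\beta;\mu)$, and $\mathrm{c}(\epsilon)=0$ if $\epsilon\le\Pr(W/(Y+1)\le\beta)$. $g(N)=\Theta(f(N))$ means $\phi_1f(N)<g(N)<\phi_2f(N)$ for all large $N$ with positive constants $\phi_1,\phi_2$ independent of $N$. *)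

theory Defs
  imports "HOL-Probability.Probability"
begin

datatype receiver = MRC | ZF

text \<open>
  The Gamma law with integer shape \<open>v \<ge> 1\<close> and scale \<open>\<theta> > 0\<close>, whose density is
  \<open>x ^ (v - 1) * exp (- x / \<theta>) / (\<theta> ^ v * fact (v - 1))\<close> for \<open>x \<ge> 0\<close>.  The library's
  \<open>erlang_density k l\<close> is the density of the Gamma law with shape \<open>k + 1\<close> and rate \<open>l\<close>.
\<close>

definition gamma_distributed ::
  "'a measure \<Rightarrow> ('a \<Rightarrow> real) \<Rightarrow> nat \<Rightarrow> real \<Rightarrow> bool" where
  "gamma_distributed P Z v \<theta> \<longleftrightarrow>
     distributed P lborel Z (\<lambda>x. ennreal (erlang_density (v - 1) (1 / \<theta>) x))"

definition point_count :: "(nat \<Rightarrow> 'a \<Rightarrow> real^2) \<Rightarrow> (real^2) set \<Rightarrow> 'a \<Rightarrow> nat" where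
  "point_count X B \<omega> = card {l. X l \<omega> \<in> B}"

text \<open>
  A homogeneous Poisson point process of intensity \<open>\<mu> > 0\<close> on the plane, given by a measurable
  enumeration \<open>X 0, X 1, \<dots>\<close> of its (almost surely infinitely many) points: the number of points
  in a bounded Borel set is almost surely finite and Poisson distributed with mean \<open>\<mu>\<close> times the
  area, and the numbers of points in disjoint bounded Borel sets are independent.  Almost sure
  finiteness is required separately because \<open>card\<close> vanishes on infinite sets; the Poisson weights
  are written out because \<open>poisson_pmf\<close> is unspecified at rate 0, which null sets need.
\<close>

definition homogeneous_PPP ::
  "'a measure \<Rightarrow> real \<Rightarrow> (nat \<Rightarrow> 'a \<Rightarrow> real^2) \<Rightarrow> bool" where
  "homogeneous_PPP P \<mu> X \<longleftrightarrow>
     (\<forall>l. X l \<in> borel_measurable P) \<and>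
     (\<forall>B \<in> sets borel. bounded B \<longrightarrow>
        (AE \<omega> in P. finite {l. X l \<omega> \<in> B}) \<and>
        (\<forall>k. measure P {\<omega> \<in> space P. point_count X B \<omega> = k} =
               (\<mu> * measure lborel B) ^ k / fact k * exp (- (\<mu> * measure lborel B)))) \<and>
     (\<forall>B :: nat \<Rightarrow> (real^2) set.
        (\<forall>j. B j \<in> sets borel \<and> bounded (B j)) \<and> disjoint_family B \<longrightarrow>
        prob_space.indep_vars P (\<lambda>_. count_space UNIV) (\<lambda>j. point_count X (B j)) UNIV)"

text \<open>
  The random variables entering the SINR of a stream, with \<open>N\<close> antennas, \<open>M\<close> streams and
  interferer intensity \<open>\<mu>\<close>.  Mutual independence of the point process and of all the real
  variables is expressed in two steps: the real variables \<open>W, Y, \<Psi> 0, \<Psi> 1, \<dots>\<close> are mutually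
  independent, and as a family they are independent of the whole sequence \<open>X\<close>.
  (\<open>indep_var\<close> itself does not apply, as \<open>real^2\<close> and \<open>real\<close> are different types.)
\<close>

definition stream_model ::
  "receiver \<Rightarrow> real \<Rightarrow> real \<Rightarrow> real \<Rightarrow> nat \<Rightarrow> nat \<Rightarrow> real \<Rightarrow> 'a measure \<Rightarrow>
   (nat \<Rightarrow> 'a \<Rightarrow> real^2) \<Rightarrow> (nat \<Rightarrow> 'a \<Rightarrow> real) \<Rightarrow> ('a \<Rightarrow> real) \<Rightarrow> ('a \<Rightarrow> real) \<Rightarrow> bool" where
  "stream_model rcv \<alpha> \<rho> r N M \<mu> P X \<Psi> W Y \<longleftrightarrow>
     prob_space P \<and>
     homogeneous_PPP P \<mu> X \<and>
     (\<forall>l. gamma_distributed P (\<Psi> l) M (\<rho> / M)) \<and>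
     (case rcv of
        MRC \<Rightarrow>
          gamma_distributed P W N (\<rho> / (M * r powr \<alpha>)) \<and>
          (if M = 1 then AE \<omega> in P. Y \<omega> = 0
           else gamma_distributed P Y (M - 1) (\<rho> / (M * r powr \<alpha>)))
      | ZF \<Rightarrow>
          gamma_distributed P W (N - M + 1) (\<rho> / (M * r powr \<alpha>)) \<and>
          (AE \<omega> in P. Y \<omega> = 0)) \<and>
     prob_space.indep_vars P (\<lambda>_. borel) (case_nat W (case_nat Y \<Psi>)) UNIV \<and>
     prob_space.indep_set P
       (sets (vimage_algebra (space P) (\<lambda>\<omega> l. X l \<omega>) (\<Pi>\<^sub>M l\<in>UNIV. borel)))
       (sets (vimage_algebra (space P) (\<lambda>\<omega> i. case_nat W (case_nat Y \<Psi>) i \<omega>)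
                (\<Pi>\<^sub>M i\<in>UNIV. borel)))"

text \<open>For \<open>\<alpha> > 2\<close> the interference series converges almost surely.\<close>

definition sinr ::
  "real \<Rightarrow> (nat \<Rightarrow> 'a \<Rightarrow> real^2) \<Rightarrow> (nat \<Rightarrow> 'a \<Rightarrow> real) \<Rightarrow> ('a \<Rightarrow> real) \<Rightarrow> ('a \<Rightarrow> real) \<Rightarrow>
   'a \<Rightarrow> real" where
  "sinr \<alpha> X \<Psi> W Y \<omega> = W \<omega> / (Y \<omega> + (\<Sum>l. norm (X l \<omega>) powr (- \<alpha>) * \<Psi> l \<omega>) + 1)"

definition outage_prob ::
  "'a measure \<Rightarrow> real \<Rightarrow> (nat \<Rightarrow> 'a \<Rightarrow> real^2) \<Rightarrow> (nat \<Rightarrow> 'a \<Rightarrow> real) \<Rightarrow> ('a \<Rightarrow> real) \<Rightarrow>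
   ('a \<Rightarrow> real) \<Rightarrow> real \<Rightarrow> real" where
  "outage_prob P \<alpha> X \<Psi> W Y \<beta> = measure P {\<omega> \<in> space P. sinr \<alpha> X \<Psi> W Y \<omega> \<le> \<beta>}"

text \<open>Here \<open>X \<mu>\<close> and \<open>\<Psi> \<mu>\<close> are the interferers and their marks at intensity \<open>\<mu>\<close>.\<close>

definition transmission_capacity ::
  "'a measure \<Rightarrow> real \<Rightarrow> real \<Rightarrow> nat \<Rightarrow> (real \<Rightarrow> nat \<Rightarrow> 'a \<Rightarrow> real^2) \<Rightarrow>
   (real \<Rightarrow> nat \<Rightarrow> 'a \<Rightarrow> real) \<Rightarrow> ('a \<Rightarrow> real) \<Rightarrow> ('a \<Rightarrow> real) \<Rightarrow> real \<Rightarrow> real" where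
  "transmission_capacity P \<alpha> \<beta> M X \<Psi> W Y \<epsilon> =
     (if \<epsilon> \<le> measure P {\<omega> \<in> space P. W \<omega> / (Y \<omega> + 1) \<le> \<beta>} then 0
      else real M * (THE \<mu>. 0 < \<mu> \<and> \<epsilon> = outage_prob P \<alpha> (X \<mu>) (\<Psi> \<mu>) W Y \<beta>) * (1 - \<epsilon>))"

definition beta_bar :: "receiver \<Rightarrow> real \<Rightarrow> real \<Rightarrow> real \<Rightarrow> real \<Rightarrow> real" where
  "beta_bar rcv \<alpha> \<rho> r \<kappa> =
     (case rcv of
        MRC \<Rightarrow> 1 / (\<kappa> * (r powr \<alpha> / \<rho> + 1))
      | ZF \<Rightarrow> \<rho> / r powr \<alpha> * (1 / \<kappa> - 1))"

text \<open>
  \<open>g = \<Theta>(f)\<close> as \<open>N\<close> tends to infinity within the set \<open>S\<close>.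
\<close>

definition Theta_within :: "nat set \<Rightarrow> (nat \<Rightarrow> real) \<Rightarrow> (nat \<Rightarrow> real) \<Rightarrow> bool" where
  "Theta_within S g f \<longleftrightarrow>
     (\<exists>\<phi>1 > 0. \<exists>\<phi>2 > 0. \<forall>\<^sub>F N in sequentially. N \<in> S \<longrightarrow> \<phi>1 * f N < g N \<and> g N < \<phi>2 * f N)"

end

theory Submission
  imports Defs "HOL-Real_Asymp.Real_Asymp"
begin

text \<open>
  Scaling the plane shows that the interference at intensity \<open>\<mu>\<close> has the law of
  \<open>\<mu> powr (\<alpha> / 2)\<close> times that at intensity 1: its Laplace transform at \<open>s\<close> is
  \<open>exp (- \<mu> * s powr (2 / \<alpha>) * K)\<close>.  Conditioning on everything but \<open>W\<close>, whose distribution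
  function is continuous and strictly increasing, the outage probability is therefore continuous
  and strictly increasing in \<open>\<mu>\<close> with limit 1, so that \<open>\<mu>(\<epsilon>)\<close> is well defined.

  The exponent \<open>K\<close> depends on \<open>M\<close> but, by Bernoulli's inequality, stays between two positive
  constants.  As \<open>W\<close> has mean at most of order \<open>N / M\<close>, an outage probability below 1 forces
  \<open>\<mu> \<le> C * (N / M) powr (2 / \<alpha>)\<close>, hence \<open>M * \<mu> \<le> C * N * (M / N) powr (1 - 2 / \<alpha>)\<close>; this
  gives both upper bounds.  For \<open>M = \<kappa> N\<close> the variables \<open>W\<close> and \<open>Y\<close> concentrate, and
  \<open>\<beta> < beta_bar\<close> says that their limits leave room for a positive interference, so an outage
  probability of \<open>\<epsilon>\<close> needs an intensity bounded below.
\<close>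

section \<open>Independence and Poisson point processes\<close>

text \<open>The models at different intensities share one space and the same \<open>W\<close> and
  \<open>Y\<close>, but nothing is assumed about the joint law of their interferers. Continuity and
  monotonicity in the intensity are therefore not pathwise facts: each outage probability is
  rewritten through the one process at intensity 1 times a deterministic factor, and in that factor
  the argument is pathwise. The point process is known only through its counts in bounded sets, so
  its Laplace functional has to be derived from them. Infinite products are infima of decreasing
  partial products in \<open>ennreal\<close>; this presupposes no convergence of the interference
  series, whose almost sure convergence is itself read off from the resulting Laplace transform. The
  interference has no explicit distribution in general, and its mean is infinite because of the
  singularity of the path loss at the origin. Hence both of its tails are bounded through the
  Laplace transform at the reciprocal of the threshold, instead of through moments.\<close>

lemma (in prob_space) indep_set_nn_integral:
  assumes [measurable]: "X \<in> measurable M S" "Z \<in> measurable M T"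
    and ind: "indep_set (sets (vimage_algebra (space M) X S)) (sets (vimage_algebra (space M) Z T))"
    and [measurable]: "f \<in> borel_measurable (S \<Otimes>\<^sub>M T)"
  shows "(\<integral>\<^sup>+\<omega>. f (X \<omega>, Z \<omega>) \<partial>M) = (\<integral>\<^sup>+\<omega>. (\<integral>\<^sup>+\<omega>'. f (X \<omega>, Z \<omega>') \<partial>M) \<partial>M)"
proof -
  interpret X: prob_space "distr M S X" by (rule prob_space_distr) simp
  interpret Z: prob_space "distr M T Z" by (rule prob_space_distr) simp
  \<comment> \<open>Independence of the generated sigma-algebras says that the joint law agrees with
    the product law on rectangles; the rest is Tonelli. Arguing with sigma-algebras lets
    \<open>X\<close> and \<open>Z\<close> have different value types, as points and marks
    do.\<close>
  have "distr M S X \<Otimes>\<^sub>M distr M T Z = distr M (S \<Otimes>\<^sub>M T) (\<lambda>\<omega>. (X \<omega>, Z \<omega>))"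
  proof (rule pair_measure_eqI)
    fix A B assume "A \<in> sets (distr M S X)" "B \<in> sets (distr M T Z)"
    then have [measurable]: "A \<in> sets S" "B \<in> sets T" by auto
    have "X \<in> space M \<rightarrow> space S" "Z \<in> space M \<rightarrow> space T"
      using measurable_space[of X M S] measurable_space[of Z M T] by auto
    then have "X -` A \<inter> space M \<in> sets (vimage_algebra (space M) X S)"
      "Z -` B \<inter> space M \<in> sets (vimage_algebra (space M) Z T)"
      by (auto simp: sets_vimage_algebra2)
    from indep_setD[OF ind this]
    have "prob (X -` A \<inter> space M) * prob (Z -` B \<inter> space M) =
        prob (X -` A \<inter> space M \<inter> (Z -` B \<inter> space M))"
      by simp
    also have "X -` A \<inter> space M \<inter> (Z -` B \<inter> space M) = (\<lambda>\<omega>. (X \<omega>, Z \<omega>)) -` (A \<times> B) \<inter> space M"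
      by auto
    finally show "emeasure (distr M S X) A * emeasure (distr M T Z) B =
        emeasure (distr M (S \<Otimes>\<^sub>M T) (\<lambda>\<omega>. (X \<omega>, Z \<omega>))) (A \<times> B)"
      by (simp add: emeasure_distr emeasure_eq_measure ennreal_mult[symmetric])
  qed (auto intro: X.sigma_finite_measure_axioms Z.sigma_finite_measure_axioms
      simp: sets_pair_measure_cong[of "distr M S X" S "distr M T Z" T])
  then have "(\<integral>\<^sup>+\<omega>. f (X \<omega>, Z \<omega>) \<partial>M) = (\<integral>\<^sup>+p. f p \<partial>(distr M S X \<Otimes>\<^sub>M distr M T Z))"
    by (simp add: nn_integral_distr)
  also have "\<dots> = (\<integral>\<^sup>+x. (\<integral>\<^sup>+z. f (x, z) \<partial>distr M T Z) \<partial>distr M S X)"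
    by (rule Z.nn_integral_fst[symmetric]) simp
  also have "\<dots> = (\<integral>\<^sup>+\<omega>. (\<integral>\<^sup>+z. f (X \<omega>, z) \<partial>distr M T Z) \<partial>M)"
    by (subst nn_integral_distr) auto
  also have "\<dots> = (\<integral>\<^sup>+\<omega>. (\<integral>\<^sup>+\<omega>'. f (X \<omega>, Z \<omega>') \<partial>M) \<partial>M)"
    by (intro nn_integral_cong, subst nn_integral_distr)
      (auto intro: measurable_space[OF assms(1)])
  finally show ?thesis .
qed

lemma (in prob_space) indep_var_imp_indep_set_vimage:
  assumes "indep_var S X T Z"
  shows "indep_set (sets (vimage_algebra (space M) X S)) (sets (vimage_algebra (space M) Z T))"
proof -
  have "sets (vimage_algebra (space M) f K) =
      sigma_sets (space M) {f -` A \<inter> space M |A. A \<in> sets K}" for f and K :: "'b measure"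
    unfolding vimage_algebra_def by (rule sets_measure_of) auto
  then show ?thesis
    using assms unfolding indep_var_eq by simp
qed

text \<open>Meant for the sequence \<open>W, Y, \<Psi> 0, \<Psi> 1, \<dots>\<close>, whose head is
  \<open>W\<close>. The blocks of coordinates \<open>range Suc\<close> and \<open>{0}\<close> of an
  independent family are independent of each other; \<open>?h\<close> only turns restricted
  functions back into a shifted sequence and a number.\<close>

lemma (in prob_space) indep_vars_nn_integral_head:
  fixes Z :: "nat \<Rightarrow> 'a \<Rightarrow> real"
  assumes Z: "indep_vars (\<lambda>_. borel) Z UNIV"
    and [measurable]: "f \<in> borel_measurable ((\<Pi>\<^sub>M i\<in>UNIV. borel) \<Otimes>\<^sub>M borel)"
  shows "(\<integral>\<^sup>+\<omega>. f (\<lambda>i. Z (Suc i) \<omega>, Z 0 \<omega>) \<partial>M) =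
    (\<integral>\<^sup>+\<omega>. (\<integral>\<^sup>+\<omega>'. f (\<lambda>i. Z (Suc i) \<omega>, Z 0 \<omega>') \<partial>M) \<partial>M)"
proof -
  have [measurable]: "Z i \<in> borel_measurable M" for i
    using Z by (auto simp: indep_vars_def)
  let ?T = "range Suc"
  have ind: "indep_var (PiM ?T (\<lambda>_. borel)) (\<lambda>\<omega>. restrict (\<lambda>i. Z i \<omega>) ?T)
      (PiM {0} (\<lambda>_. borel)) (\<lambda>\<omega>. restrict (\<lambda>i. Z i \<omega>) {0})"
    by (rule indep_var_restrict[OF Z]) auto
  let ?h = "\<lambda>p :: (nat \<Rightarrow> real) \<times> (nat \<Rightarrow> real). (\<lambda>i. fst p (Suc i), snd p 0)"
  have "(\<lambda>p. fst p (Suc i)) \<in> borel_measurable (PiM ?T (\<lambda>_. borel) \<Otimes>\<^sub>M PiM {0} (\<lambda>_. borel))" for i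
    by (rule measurable_compose[OF measurable_fst measurable_component_singleton]) simp
  moreover have "(\<lambda>p. snd p 0) \<in> borel_measurable (PiM ?T (\<lambda>_. borel) \<Otimes>\<^sub>M PiM {0} (\<lambda>_. borel))"
    by (rule measurable_compose[OF measurable_snd measurable_component_singleton]) simp
  ultimately have h: "?h \<in> measurable (PiM ?T (\<lambda>_. borel) \<Otimes>\<^sub>M PiM {0} (\<lambda>_. borel))
      ((\<Pi>\<^sub>M i\<in>UNIV. borel) \<Otimes>\<^sub>M borel)"
    by (intro measurable_Pair measurable_PiM_single') (simp_all add: PiE_UNIV_domain)
  have fh: "(\<lambda>p. f (?h p)) \<in> borel_measurable (PiM ?T (\<lambda>_. borel) \<Otimes>\<^sub>M PiM {0} (\<lambda>_. borel))"
    by (rule measurable_compose[OF h]) simp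
  have "random_variable (PiM J (\<lambda>_. borel)) (\<lambda>\<omega>. restrict (\<lambda>i. Z i \<omega>) J)" for J
    by (rule measurable_restrict) simp
  from indep_set_nn_integral[OF this this indep_var_imp_indep_set_vimage[OF ind] fh]
  show ?thesis by simp
qed

lemma measurable_fst_component:
  "(\<lambda>p. fst p i) \<in> borel_measurable ((\<Pi>\<^sub>M i\<in>UNIV. borel) \<Otimes>\<^sub>M N)"
  by (rule measurable_compose[OF measurable_fst measurable_component_singleton]) simp

lemma measurable_snd_component:
  "(\<lambda>p. snd p i) \<in> borel_measurable (N \<Otimes>\<^sub>M (\<Pi>\<^sub>M i\<in>UNIV. borel))"
  by (rule measurable_compose[OF measurable_snd measurable_component_singleton]) simp

text \<open>Summing \<open>c ^ k\<close> against the Poisson weights is an exponential series. Mean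
  0 has to be covered because null sets occur among the level sets of the step functions
  below.\<close>

lemma (in prob_space) poisson_pgf:
  fixes N :: "'a \<Rightarrow> nat"
  assumes N[measurable]: "N \<in> measurable M (count_space UNIV)" and "0 \<le> m" "0 \<le> c"
    and N_eq: "\<And>k. prob {\<omega> \<in> space M. N \<omega> = k} = m ^ k / fact k * exp (- m)"
  shows "(\<integral>\<^sup>+\<omega>. ennreal (c ^ N \<omega>) \<partial>M) = ennreal (exp (- (m * (1 - c))))"
proof -
  have "(\<integral>\<^sup>+\<omega>. ennreal (c ^ N \<omega>) \<partial>M) =
      (\<integral>\<^sup>+\<omega>. (\<Sum>k. ennreal (c ^ k) * indicator {\<omega> \<in> space M. N \<omega> = k} \<omega>) \<partial>M)"
  proof (rule nn_integral_cong)
    fix \<omega> assume "\<omega> \<in> space M"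
    then have "(\<Sum>k. ennreal (c ^ k) * indicator {\<omega> \<in> space M. N \<omega> = k} \<omega>) =
        (\<Sum>k. if N \<omega> = k then ennreal (c ^ k) else 0)"
      by (intro suminf_cong) (auto split: split_indicator)
    also have "\<dots> = ennreal (c ^ N \<omega>)"
      using suminf_finite[of "{N \<omega>}" "\<lambda>k. if N \<omega> = k then ennreal (c ^ k) else 0"] by auto
    finally show "ennreal (c ^ N \<omega>) = (\<Sum>k. ennreal (c ^ k) * indicator {\<omega> \<in> space M. N \<omega> = k} \<omega>)"
      by simp
  qed
  also have "\<dots> = (\<Sum>k. ennreal (c ^ k) * emeasure M {\<omega> \<in> space M. N \<omega> = k})"
    by (subst nn_integral_suminf) (auto simp: nn_integral_cmult_indicator)
  also have "\<dots> = (\<Sum>k. ennreal (exp (- m) * (inverse (fact k) * (c * m) ^ k)))"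
    using assms(2,3) by (intro suminf_cong)
      (simp add: emeasure_eq_measure N_eq ennreal_mult[symmetric] power_mult_distrib divide_inverse mult_ac)
  also have "\<dots> = ennreal (exp (- m) * exp (c * m))"
  proof (rule suminf_ennreal_eq)
    show "(\<lambda>k. exp (- m) * (inverse (fact k) * (c * m) ^ k)) sums (exp (- m) * exp (c * m))"
      using exp_converges[of "c * m"] by (intro sums_mult) simp
  qed (use assms in auto)
  also have "exp (- m) * exp (c * m) = exp (- (m * (1 - c)))"
    by (simp add: exp_add[symmetric] algebra_simps)
  finally show ?thesis .
qed

text \<open>Almost surely only finitely many points lie in the first \<open>n\<close> sets, so the
  partial products over the points are eventually constant. Exchanging the two products collects a
  factor \<open>c j\<close> for each point in \<open>B j\<close>, and the resulting powers of
  independent Poisson counts have known means.\<close>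

lemma homogeneous_PPP_step:
  fixes X :: "nat \<Rightarrow> 'a \<Rightarrow> real^2" and B :: "nat \<Rightarrow> (real^2) set" and c :: "nat \<Rightarrow> real"
  assumes "prob_space P" and PPP: "homogeneous_PPP P \<mu> X" and "0 < \<mu>"
    and B: "\<And>j. B j \<in> sets borel" "\<And>j. bounded (B j)" "disjoint_family B"
    and c: "\<And>j. 0 \<le> c j" "\<And>j. c j \<le> 1"
  shows "(\<integral>\<^sup>+\<omega>. (INF m. \<Prod>l<m. ennreal (\<Prod>j<n. if X l \<omega> \<in> B j then c j else 1)) \<partial>P) =
    ennreal (exp (- (\<mu> * (\<Sum>j<n. measure lborel (B j) * (1 - c j)))))"
proof -
  interpret prob_space P by fact
  have fin: "AE \<omega> in P. \<forall>j. finite {l. X l \<omega> \<in> B j}"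
    using PPP B unfolding homogeneous_PPP_def AE_all_countable by auto
  have ind: "indep_vars (\<lambda>_. count_space UNIV) (\<lambda>j. point_count X (B j)) UNIV"
    using PPP B unfolding homogeneous_PPP_def by auto
  then have [measurable]: "point_count X (B j) \<in> measurable P (count_space UNIV)" for j
    by (auto simp: indep_vars_def)
  have "(\<integral>\<^sup>+\<omega>. (INF m. \<Prod>l<m. ennreal (\<Prod>j<n. if X l \<omega> \<in> B j then c j else 1)) \<partial>P) =
      (\<integral>\<^sup>+\<omega>. (\<Prod>j<n. ennreal (c j ^ point_count X (B j) \<omega>)) \<partial>P)"
  proof (rule nn_integral_cong_AE, use fin in eventually_elim)
    case (elim \<omega>)
    let ?L = "\<lambda>j. {l. X l \<omega> \<in> B j}"
    let ?g = "\<lambda>m. \<Prod>l<m. ennreal (\<Prod>j<n. if X l \<omega> \<in> B j then c j else 1)"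
    have "finite (\<Union>j<n. ?L j)" using elim by auto
    then obtain m0 where m0: "(\<Union>j<n. ?L j) \<subseteq> {..<m0}"
      using finite_nat_bounded by blast
    have ev: "?g m = (\<Prod>j<n. ennreal (c j ^ point_count X (B j) \<omega>))" if "m0 \<le> m" for m
    proof -
      have "?g m = ennreal (\<Prod>l<m. \<Prod>j<n. if X l \<omega> \<in> B j then c j else 1)"
        using c by (subst prod_ennreal) (auto intro!: prod_nonneg)
      also have "(\<Prod>l<m. \<Prod>j<n. if X l \<omega> \<in> B j then c j else 1) =
          (\<Prod>j<n. \<Prod>l<m. if X l \<omega> \<in> B j then c j else 1)"
        by (rule prod.swap)
      also have "\<dots> = (\<Prod>j<n. c j ^ point_count X (B j) \<omega>)"
      proof (rule prod.cong)
        fix j assume j: "j \<in> {..<n}"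
        have "(\<Prod>l<m. if X l \<omega> \<in> B j then c j else 1) = (\<Prod>l\<in>{..<m} \<inter> ?L j. c j)"
          using prod.inter_restrict[of "{..<m}" "\<lambda>_. c j" "?L j"] by (simp only: mem_Collect_eq finite_lessThan)
        also have "{..<m} \<inter> ?L j = ?L j" using m0 that j by force
        finally show "(\<Prod>l<m. if X l \<omega> \<in> B j then c j else 1) = c j ^ point_count X (B j) \<omega>"
          by (simp add: point_count_def)
      qed simp
      finally show ?thesis using c by (simp add: prod_ennreal)
    qed
    have "decseq ?g"
    proof (rule decseq_SucI)
      fix m
      have "?g m * ennreal (\<Prod>j<n. if X m \<omega> \<in> B j then c j else 1) \<le> ?g m * 1"
        using c by (intro mult_left_mono) (auto intro!: prod_le_1)
      then show "?g (Suc m) \<le> ?g m" by simp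
    qed
    then have "?g \<longlonglongrightarrow> (INF m. ?g m)" by (rule LIMSEQ_INF)
    moreover have "?g \<longlonglongrightarrow> (\<Prod>j<n. ennreal (c j ^ point_count X (B j) \<omega>))"
      by (rule tendsto_eventually) (use ev eventually_sequentially in blast)
    ultimately show ?case by (rule LIMSEQ_unique)
  qed
  also have "\<dots> = (\<Prod>j<n. \<integral>\<^sup>+\<omega>. ennreal (c j ^ point_count X (B j) \<omega>) \<partial>P)"
  proof (rule indep_vars_nn_integral)
    show "indep_vars (\<lambda>_. borel) (\<lambda>j \<omega>. ennreal (c j ^ point_count X (B j) \<omega>)) {..<n}"
      by (rule indep_vars_subset[OF indep_vars_compose2[OF ind,
            where Y = "\<lambda>j k. ennreal (c j ^ k)" and N = "\<lambda>_. borel"]]) auto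
  qed auto
  also have "\<dots> = (\<Prod>j<n. ennreal (exp (- (\<mu> * measure lborel (B j) * (1 - c j)))))"
    using PPP B c \<open>0 < \<mu>\<close>
    by (intro prod.cong refl poisson_pgf) (auto simp: homogeneous_PPP_def)
  also have "\<dots> = ennreal (exp (\<Sum>j<n. - (\<mu> * measure lborel (B j) * (1 - c j))))"
    by (simp add: prod_ennreal exp_sum)
  also have "(\<Sum>j<n. - (\<mu> * measure lborel (B j) * (1 - c j))) =
      - (\<mu> * (\<Sum>j<n. measure lborel (B j) * (1 - c j)))"
    by (simp add: sum_negf sum_distrib_left mult_ac)
  finally show ?thesis .
qed

text \<open>
  The infimum is the infinite product over all points.  \<open>f\<close> is approximated from below by dyadic
  step functions of bounded support, for which the product is determined by finitely many counts.
\<close>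
lemma homogeneous_PPP_laplace_functional:
  fixes X :: "nat \<Rightarrow> 'a \<Rightarrow> real^2" and f :: "real^2 \<Rightarrow> real"
  assumes P: "prob_space P" and PPP: "homogeneous_PPP P \<mu> X" and "0 < \<mu>"
    and [measurable]: "f \<in> borel_measurable borel"
    and f: "\<And>x. 0 \<le> f x" "\<And>x. f x \<le> 1" and int: "integrable lborel f"
  shows "(\<integral>\<^sup>+\<omega>. (INF m. \<Prod>l<m. ennreal (1 - f (X l \<omega>))) \<partial>P) = ennreal (exp (- (\<mu> * (\<integral>x. f x \<partial>lborel))))"
proof -
  interpret prob_space P by fact
  have [measurable]: "X l \<in> borel_measurable P" for l
    using PPP by (auto simp: homogeneous_PPP_def)
  define q where "q i x = \<lfloor>2 ^ i * f x\<rfloor>" for i :: nat and x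
  define g where "g i x = (if norm x < real i then q i x / 2 ^ i else 0)" for i x
  have q: "0 \<le> q i x" "q i x \<le> 2 ^ i" for i x
  proof -
    have "2 ^ i * f x \<le> of_int (2 ^ i)" using f(2)[of x] by simp
    then show "q i x \<le> 2 ^ i" unfolding q_def by linarith
  qed (use f in \<open>simp add: q_def\<close>)
  have [measurable]: "q i \<in> measurable borel (count_space UNIV)" for i
    unfolding q_def by measurable
  have [measurable]: "g i \<in> borel_measurable borel" for i
    unfolding g_def by measurable
  have g_nonneg: "0 \<le> g i x" for i x using q by (simp add: g_def)
  have g_le_f: "g i x \<le> f x" for i x
    using f by (auto simp: g_def q_def field_simps)
  have g_le_1: "g i x \<le> 1" for i x using g_le_f f order_trans by blast
  have g_Suc: "g i x \<le> g (Suc i) x" for i x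
  proof -
    have "2 * q i x \<le> q (Suc i) x"
      unfolding q_def le_floor_iff using of_int_floor_le[of "2 ^ i * f x"] by simp
    then have "q i x / 2 ^ i \<le> q (Suc i) x / 2 ^ Suc i"
      by (simp add: field_simps)
    then show ?thesis using q(1)[of "Suc i" x] by (auto simp: g_def)
  qed
  have g_lim: "(\<lambda>i. g i x) \<longlonglongrightarrow> f x" for x
  proof (rule real_tendsto_sandwich)
    show "\<forall>\<^sub>F i in sequentially. g i x \<le> f x" using g_le_f by simp
    show "\<forall>\<^sub>F i in sequentially. f x - 1 / 2 ^ i \<le> g i x"
    proof -
      have "\<forall>\<^sub>F i in sequentially. norm x < real i"
        by (rule eventually_compose_filterlim[OF eventually_gt_at_top filterlim_real_sequentially])
      then show ?thesis
      proof eventually_elim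
        case (elim i)
        have "2 ^ i * f x - 1 \<le> q i x" unfolding q_def by linarith
        then have "(2 ^ i * f x - 1) / 2 ^ i \<le> q i x / 2 ^ i" by (intro divide_right_mono) auto
        then show ?case using elim by (simp add: g_def diff_divide_distrib)
      qed
    qed
    show "(\<lambda>i. f x - 1 / 2 ^ i) \<longlonglongrightarrow> f x" by real_asymp
  qed auto
  have eq_i: "(\<integral>\<^sup>+\<omega>. (INF m. \<Prod>l<m. ennreal (1 - g i (X l \<omega>))) \<partial>P) =
      ennreal (exp (- (\<mu> * (\<integral>x. g i x \<partial>lborel))))" for i
  proof -
    \<comment> \<open>\<open>B j\<close> is a level set of \<open>q i\<close> inside the truncation
      ball, and \<open>c j\<close> is the value of \<open>1 - g i\<close> on it. The levels are 0 up
      to \<open>2 ^ i\<close> inclusive, whence \<open>?n\<close>; the \<open>max\<close> acts only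
      beyond them, where the step lemma still asks for \<open>0 \<le> c j\<close>.\<close>
    define B where "B j = {x. norm x < real i \<and> q i x = int j}" for j
    define c where "c j = max 0 (1 - real j / 2 ^ i)" for j
    let ?n = "Suc (2 ^ i)"
    have B: "B j \<in> sets borel" "bounded (B j)" for j
      unfolding B_def by (measurable, rule bounded_subset[OF bounded_ball[of 0 "real i"]], auto)
    then have B': "emeasure lborel (B j) < \<infinity>" for j
      using emeasure_bounded_finite by blast
    have single: "(\<Sum>j<?n. indicator (B j) x * (real j / 2 ^ i)) = g i x" for x
    proof (cases "norm x < real i")
      case True
      have "(\<Sum>j<?n. indicator (B j) x * (real j / 2 ^ i)) =
          (\<Sum>j<?n. if j = nat (q i x) then real j / 2 ^ i else 0)"
        using True q[of i x] by (intro sum.cong) (auto simp: B_def split: split_indicator)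
      also have "\<dots> = g i x"
        using True q[of i x] by (simp add: g_def nat_less_iff)
      finally show ?thesis .
    qed (simp add: g_def B_def)
    have prod: "(\<Prod>j<?n. if x \<in> B j then c j else 1) = 1 - g i x" for x
    proof (cases "norm x < real i")
      case True
      have "(\<Prod>j<?n. if x \<in> B j then c j else 1) = (\<Prod>j<?n. if j = nat (q i x) then c j else 1)"
        using True q[of i x] by (intro prod.cong) (auto simp: B_def)
      also have "\<dots> = 1 - g i x"
        using True q[of i x] g_le_1[of i x] by (simp add: g_def c_def nat_less_iff)
      finally show ?thesis .
    qed (simp add: g_def B_def)
    have "(\<integral>\<^sup>+\<omega>. (INF m. \<Prod>l<m. ennreal (1 - g i (X l \<omega>))) \<partial>P) =
      (\<integral>\<^sup>+\<omega>. (INF m. \<Prod>l<m. ennreal (\<Prod>j<?n. if X l \<omega> \<in> B j then c j else 1)) \<partial>P)"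
      by (simp only: prod)
    also have "\<dots> = ennreal (exp (- (\<mu> * (\<Sum>j<?n. measure lborel (B j) * (1 - c j)))))"
      by (rule homogeneous_PPP_step[OF P PPP \<open>0 < \<mu>\<close>])
         (use B in \<open>auto simp: disjoint_family_on_def B_def c_def\<close>)
    also have "(\<Sum>j<?n. measure lborel (B j) * (1 - c j)) =
        (\<Sum>j<?n. \<integral>x. indicator (B j) x * (real j / 2 ^ i) \<partial>lborel)"
      by (intro sum.cong) (auto simp: c_def field_simps simp flip: of_nat_power)
    also have "\<dots> = (\<integral>x. (\<Sum>j<?n. indicator (B j) x * (real j / 2 ^ i)) \<partial>lborel)"
      using B B'
      by (intro Bochner_Integration.integral_sum[symmetric] integrable_mult_left integrable_real_indicator) auto
    finally show ?thesis by (simp only: single)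
  qed
  let ?G = "\<lambda>i \<omega>. INF m. \<Prod>l<m. ennreal (1 - g i (X l \<omega>))"
  have dec: "decseq (\<lambda>i. \<Prod>l<m. ennreal (1 - g i (X l \<omega>)))" for m \<omega>
    using g_le_1 by (intro decseq_SucI) (auto simp: prod_ennreal intro!: ennreal_leI prod_mono g_Suc)
  have "decseq ?G"
    by (intro decseq_SucI le_funI INF_mono' decseq_SucD[OF dec])
  \<comment> \<open>The infima over the approximation index and over the number of factors commute,
    and for a fixed finite number of factors the product is continuous.\<close>
  have lim: "(INF i. ?G i \<omega>) = (INF m. \<Prod>l<m. ennreal (1 - f (X l \<omega>)))" for \<omega>
  proof -
    have "(INF i. \<Prod>l<m. ennreal (1 - g i (X l \<omega>))) = (\<Prod>l<m. ennreal (1 - f (X l \<omega>)))" for m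
    proof (rule LIMSEQ_unique[OF LIMSEQ_INF[OF dec]])
      have "(\<lambda>i. ennreal (\<Prod>l<m. (1 - g i (X l \<omega>)))) \<longlonglongrightarrow> ennreal (\<Prod>l<m. (1 - f (X l \<omega>)))"
        by (intro tendsto_intros g_lim)
      then show "(\<lambda>i. \<Prod>l<m. ennreal (1 - g i (X l \<omega>))) \<longlonglongrightarrow> (\<Prod>l<m. ennreal (1 - f (X l \<omega>)))"
        using g_le_1 f by (simp add: prod_ennreal)
    qed
    then show ?thesis by (subst INF_commute) simp
  qed
  have "(\<integral>\<^sup>+\<omega>. (INF i. ?G i \<omega>) \<partial>P) = (INF i. \<integral>\<^sup>+\<omega>. ?G i \<omega> \<partial>P)"
  proof (rule nn_integral_monotone_convergence_INF_decseq[OF \<open>decseq ?G\<close>])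
    show "(\<integral>\<^sup>+\<omega>. ?G 0 \<omega> \<partial>P) < \<infinity>" unfolding eq_i by simp
  qed measurable
  also have "\<dots> = ennreal (exp (- (\<mu> * (\<integral>x. f x \<partial>lborel))))"
  proof (rule LIMSEQ_unique[OF LIMSEQ_INF])
    show "decseq (\<lambda>i. \<integral>\<^sup>+\<omega>. ?G i \<omega> \<partial>P)"
      by (intro decseq_SucI nn_integral_mono le_funD[OF decseq_SucD[OF \<open>decseq ?G\<close>]])
    have "(\<lambda>i. \<integral>x. g i x \<partial>lborel) \<longlonglongrightarrow> (\<integral>x. f x \<partial>lborel)"
      by (rule integral_dominated_convergence[OF _ _ int]) (use g_lim g_nonneg g_le_f in auto)
    then show "(\<lambda>i. \<integral>\<^sup>+\<omega>. ?G i \<omega> \<partial>P) \<longlonglongrightarrow> ennreal (exp (- (\<mu> * (\<integral>x. f x \<partial>lborel))))"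
      unfolding eq_i by (intro tendsto_intros)
  qed
  finally show ?thesis by (simp only: lim)
qed

section \<open>The Laplace exponent of the interference\<close>

text \<open>Exponential tilting: multiplying the density of rate \<open>l\<close> by
  \<open>exp (- (u * x))\<close> gives a constant times the density of the same shape and rate
  \<open>l + u\<close>, which integrates to 1.\<close>

lemma (in prob_space) gamma_laplace:
  assumes "gamma_distributed M Z v \<theta>" and "1 \<le> v" "0 < \<theta>" "0 \<le> u"
  shows "(\<integral>\<^sup>+\<omega>. ennreal (exp (- (u * Z \<omega>))) \<partial>M) = ennreal ((1 / (1 + \<theta> * u)) ^ v)"
proof -
  define l where "l = 1 / \<theta>"
  let ?k = "v - 1"
  have D: "distributed M lborel Z (\<lambda>x. ennreal (erlang_density ?k l x))"
    using assms unfolding gamma_distributed_def l_def by simp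
  have l: "0 < l" "0 < l + u" using assms by (auto simp: l_def intro: add_pos_nonneg)
  have "(\<integral>\<^sup>+\<omega>. ennreal (exp (- (u * Z \<omega>))) \<partial>M) =
      (\<integral>\<^sup>+x. ennreal (erlang_density ?k l x) * ennreal (exp (- (u * x))) \<partial>lborel)"
    by (rule distributed_nn_integral[OF D, symmetric]) simp
  also have "\<dots> = (\<integral>\<^sup>+x. ennreal ((l / (l + u)) ^ v) * ennreal (erlang_density ?k (l + u) x) \<partial>lborel)"
  proof (rule nn_integral_cong)
    fix x :: real
    have "exp (- (l * x)) * exp (- (u * x)) = exp ((- l - u) * x)"
      by (simp add: exp_add[symmetric] algebra_simps)
    then have "erlang_density ?k l x * exp (- (u * x)) = (l / (l + u)) ^ v * erlang_density ?k (l + u) x"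
      using l \<open>1 \<le> v\<close> by (auto simp: erlang_density_def power_divide)
    then show "ennreal (erlang_density ?k l x) * ennreal (exp (- (u * x))) =
        ennreal ((l / (l + u)) ^ v) * ennreal (erlang_density ?k (l + u) x)"
      using l by (simp add: ennreal_mult[symmetric])
  qed
  also have "\<dots> = ennreal ((l / (l + u)) ^ v)"
    using prob_space.emeasure_space_1[OF prob_space_erlang_density[OF l(2)], of ?k]
    by (subst nn_integral_cmult) (auto simp: emeasure_density)
  also have "l / (l + u) = 1 / (1 + \<theta> * u)"
    using assms by (simp add: l_def field_simps)
  finally show ?thesis .
qed

text \<open>
  \<open>1 - gamma_shot \<alpha> (\<rho> * s) m x\<close> is the Laplace transform at \<open>s\<close> of the contribution of an
  interferer at \<open>x\<close> with a \<open>Gamma(m, \<rho> / m)\<close> mark.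
\<close>
definition gamma_shot :: "real \<Rightarrow> real \<Rightarrow> nat \<Rightarrow> real^2 \<Rightarrow> real" where
  "gamma_shot \<alpha> \<rho> m x = 1 - (1 / (1 + \<rho> / m * norm x powr (- \<alpha>))) ^ m"

lemma gamma_shot_measurable [measurable]: "gamma_shot \<alpha> \<rho> m \<in> borel_measurable borel"
  unfolding gamma_shot_def by measurable

text \<open>The last two bounds do not involve \<open>m\<close>, which makes all later constants
  independent of the number of streams. Bernoulli's inequality is used for
  \<open>1 - u / (1 + u)\<close> to get the upper one and for \<open>1 + u\<close> to get the lower
  one; the latter is the value at \<open>m = 1\<close>, the case of exponential marks.\<close>

lemma gamma_shot_bounds:
  assumes "0 < \<rho>" "1 \<le> m"
  shows "0 \<le> gamma_shot \<alpha> \<rho> m x" "gamma_shot \<alpha> \<rho> m x \<le> 1"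
    "gamma_shot \<alpha> \<rho> m x \<le> \<rho> * norm x powr (- \<alpha>)"
    "1 - 1 / (1 + \<rho> * norm x powr (- \<alpha>)) \<le> gamma_shot \<alpha> \<rho> m x"
proof -
  define u where "u = \<rho> / m * norm x powr (- \<alpha>)"
  have u: "0 \<le> u" and mu: "m * u = \<rho> * norm x powr (- \<alpha>)"
    using assms by (auto simp: u_def)
  have eq: "gamma_shot \<alpha> \<rho> m x = 1 - (1 / (1 + u)) ^ m" by (simp add: gamma_shot_def u_def)
  have "(1 / (1 + u)) ^ m \<le> 1" using u by (intro power_le_one) auto
  then show "0 \<le> gamma_shot \<alpha> \<rho> m x" by (simp add: eq)
  show "gamma_shot \<alpha> \<rho> m x \<le> 1" using u by (simp add: eq)
  have "1 + m * (- (u / (1 + u))) \<le> (1 + - (u / (1 + u))) ^ m"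
    by (rule Bernoulli_inequality) (use u in \<open>simp add: field_simps\<close>)
  also have "1 + - (u / (1 + u)) = 1 / (1 + u)" using u by (simp add: field_simps)
  finally have "gamma_shot \<alpha> \<rho> m x \<le> m * (u / (1 + u))" by (simp add: eq)
  also have "\<dots> \<le> m * u" using u by (intro mult_left_mono) (auto simp: field_simps)
  finally show "gamma_shot \<alpha> \<rho> m x \<le> \<rho> * norm x powr (- \<alpha>)" by (simp add: mu)
  have "1 + m * u \<le> (1 + u) ^ m" by (rule Bernoulli_inequality) (use u in simp)
  then have "(1 / (1 + u)) ^ m \<le> 1 / (1 + m * u)"
    using u by (simp add: power_divide frac_le add_pos_nonneg)
  then show "1 - 1 / (1 + \<rho> * norm x powr (- \<alpha>)) \<le> gamma_shot \<alpha> \<rho> m x"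
    by (simp add: eq mu)
qed

section \<open>Integrability, size and scaling of the Laplace exponent\<close>

lemma emeasure_lborel_ball_scale:
  assumes "0 \<le> c"
  shows "emeasure lborel (ball (0 :: real^2) c) = ennreal (c\<^sup>2 * measure lborel (ball (0 :: real^2) 1))"
proof -
  have "measure lborel (ball (0 :: real^2) c) = c\<^sup>2 * measure lborel (ball (0 :: real^2) 1)"
    using content_ball_conv_unit_ball[OF assms, of "0 :: real^2"] by simp
  then show ?thesis
    using emeasure_lborel_ball_finite[of "0 :: real^2" c]
    by (simp add: emeasure_eq_ennreal_measure less_top)
qed

text \<open>Domination by a dyadic sum: the ball of radius \<open>2 ^ k\<close> has area of order
  \<open>4 ^ k\<close> and the integrand outside the previous ball is of order
  \<open>(2 powr - \<alpha>) ^ k\<close>. The geometric ratio \<open>4 * 2 powr - \<alpha>\<close>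
  is below 1 because \<open>2 < \<alpha>\<close>.\<close>

lemma integrable_min_one_norm_powr:
  assumes "2 < \<alpha>" "0 < \<rho>"
  shows "integrable lborel (\<lambda>x::real^2. min 1 (\<rho> * norm x powr (- \<alpha>)))"
proof (rule integrableI_nonneg)
  define b where "b = measure lborel (ball (0 :: real^2) 1)"
  \<comment> \<open>Large enough for both cases below: at least 1 for the unit ball, and at least
    \<open>\<rho> * 2 powr \<alpha>\<close> for the shells, where \<open>norm x\<close> is only
    known to be at least half of \<open>2 ^ k\<close>.\<close>
  define C where "C = (1 + \<rho>) * 2 powr \<alpha>"
  have C: "1 \<le> C" "\<rho> * 2 powr \<alpha> \<le> C"
    using assms ge_one_powr_ge_zero[of 2 \<alpha>] mult_mono[of 1 "1 + \<rho>" 1 "2 powr \<alpha>"] by (auto simp: C_def)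
  define w where "w k x = ennreal (C * (2 powr - \<alpha>) ^ k) * indicator (ball 0 (2 ^ k)) x" for k and x :: "real^2"
  have w_measurable: "w k \<in> borel_measurable lborel" for k
    unfolding w_def by (intro borel_measurable_times_ennreal borel_measurable_indicator) auto
  have w: "((2::real) powr (- \<alpha>)) ^ k = (2 ^ k) powr (- \<alpha>)" for k
    by (induction k) (auto simp: powr_mult)
  have le: "ennreal (min 1 (\<rho> * norm x powr (- \<alpha>))) \<le> (\<Sum>k. w k x)" for x :: "real^2"
  proof -
    obtain k0 where "norm x < 2 ^ k0" using real_arch_pow[of 2 "norm x"] by auto
    define k where "k = (LEAST k. norm x < 2 ^ k)"
    have k: "norm x < 2 ^ k" unfolding k_def by (rule LeastI) fact
    have "min 1 (\<rho> * norm x powr (- \<alpha>)) \<le> C * (2 powr - \<alpha>) ^ k"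
    proof (cases k)
      case 0 then show ?thesis using C by simp
    next
      case (Suc j)
      then have "\<not> norm x < 2 ^ j" using not_less_Least[of j "\<lambda>k. norm x < 2 ^ k"] by (auto simp: k_def)
      then have j: "2 ^ j \<le> norm x" by simp
      have "\<rho> * norm x powr (- \<alpha>) \<le> \<rho> * (2 ^ j) powr (- \<alpha>)"
        using assms j by (intro mult_left_mono powr_mono2') auto
      also have "\<dots> = \<rho> * 2 powr \<alpha> * (2 powr - \<alpha>) ^ k"
        unfolding w by (simp add: Suc powr_mult powr_minus field_simps)
      also have "\<dots> \<le> C * (2 powr - \<alpha>) ^ k" using C by (intro mult_right_mono) auto
      finally show ?thesis by simp
    qed
    then have "ennreal (min 1 (\<rho> * norm x powr (- \<alpha>))) \<le> w k x"
      using k by (auto simp: w_def intro!: ennreal_leI)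
    also have "\<dots> \<le> (\<Sum>k. w k x)" using sum_le_suminf[of "\<lambda>k. w k x" "{k}"] by simp
    finally show ?thesis .
  qed
  have r: "(2 powr - \<alpha>) * 4 < 1"
  proof -
    have "(2 powr - \<alpha>) * 4 = 2 powr (2 - \<alpha>)" by (simp add: powr_diff powr_minus field_simps)
    also have "\<dots> < 2 powr 0" using assms by (intro powr_less_mono) auto
    finally show ?thesis by simp
  qed
  have "(\<integral>\<^sup>+x. ennreal (min 1 (\<rho> * norm x powr (- \<alpha>))) \<partial>(lborel :: (real^2) measure)) \<le>
      (\<integral>\<^sup>+x. (\<Sum>k. w k x) \<partial>(lborel :: (real^2) measure))"
    by (intro nn_integral_mono le)
  also have "\<dots> = (\<Sum>k. \<integral>\<^sup>+x. w k x \<partial>(lborel :: (real^2) measure))"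
    by (rule nn_integral_suminf) (rule w_measurable)
  also have "\<dots> = (\<Sum>k. ennreal (C * b * ((2 powr - \<alpha>) * 4) ^ k))"
  proof (rule suminf_cong)
    fix k
    have four: "((2::real) ^ k)\<^sup>2 = 4 ^ k"
      by (simp add: power2_eq_square flip: power_mult_distrib)
    have "(\<integral>\<^sup>+x. w k x \<partial>(lborel :: (real^2) measure)) =
        ennreal (C * (2 powr - \<alpha>) ^ k) * ennreal ((2 ^ k)\<^sup>2 * b)"
      unfolding w_def b_def by (subst nn_integral_cmult_indicator) (auto simp: emeasure_lborel_ball_scale)
    also have "\<dots> = ennreal (C * b * ((2 powr - \<alpha>) * 4) ^ k)"
      using C four by (simp add: ennreal_mult[symmetric] b_def power_mult_distrib mult_ac)
    finally show "(\<integral>\<^sup>+x. w k x \<partial>(lborel :: (real^2) measure)) = ennreal (C * b * ((2 powr - \<alpha>) * 4) ^ k)" .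
  qed
  also have "\<dots> = ennreal (\<Sum>k. C * b * ((2 powr - \<alpha>) * 4) ^ k)"
    using r C by (intro suminf_ennreal2 summable_mult summable_geometric) (auto simp: b_def)
  also have "\<dots> < \<infinity>" by simp
  finally show "(\<integral>\<^sup>+x. ennreal (min 1 (\<rho> * norm x powr (- \<alpha>))) \<partial>(lborel :: (real^2) measure)) < \<infinity>" .
qed (use assms in auto)

lemma gamma_shot_integrable:
  assumes "2 < \<alpha>" "0 < \<rho>" "1 \<le> m"
  shows "integrable lborel (gamma_shot \<alpha> \<rho> m)"
  by (rule Bochner_Integration.integrable_bound[OF integrable_min_one_norm_powr[OF assms(1,2)]])
    (use gamma_shot_bounds[OF assms(2,3)] assms in auto)

text \<open>The \<open>K\<close> of the overview. With \<open>\<rho> * s\<close> in place of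
  \<open>\<rho>\<close> it is the Laplace exponent of the interference at \<open>s\<close> for unit
  intensity.\<close>

definition shot_exponent :: "real \<Rightarrow> real \<Rightarrow> nat \<Rightarrow> real" where
  "shot_exponent \<alpha> \<rho> m = (\<integral>x. gamma_shot \<alpha> \<rho> m x \<partial>lborel)"

lemma shot_exponent_upper:
  assumes "2 < \<alpha>" "0 < \<rho>" "1 \<le> m"
  shows "shot_exponent \<alpha> \<rho> m \<le> (\<integral>x. min 1 (\<rho> * norm x powr (- \<alpha>)) \<partial>(lborel :: (real^2) measure))"
  unfolding shot_exponent_def
  by (intro integral_mono gamma_shot_integrable integrable_min_one_norm_powr assms)
    (use gamma_shot_bounds[OF assms(2,3)] in auto)

lemma shot_exponent_lower:
  assumes "2 < \<alpha>" "0 < \<rho>" "1 \<le> m"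
  shows "\<rho> / (1 + \<rho>) * measure lborel (ball (0 :: real^2) 1) \<le> shot_exponent \<alpha> \<rho> m"
proof -
  \<comment> \<open>At the origin \<open>powr\<close> returns 0, so \<open>gamma_shot\<close>
    vanishes there and the lower bound on the unit ball fails at this single point.\<close>
  have "AE x in lborel. x \<noteq> (0 :: real^2)" by (rule AE_lborel_singleton)
  then have "AE x in lborel. indicator (ball (0 :: real^2) 1) x * (\<rho> / (1 + \<rho>)) \<le> gamma_shot \<alpha> \<rho> m x"
  proof eventually_elim
    case (elim x)
    show ?case
    proof (cases "x \<in> ball 0 1")
      case True
      then have "1 \<le> norm x powr (- \<alpha>)"
        using elim assms powr_mono2'[of "- \<alpha>" "norm x" 1] by auto
      then have "\<rho> \<le> \<rho> * norm x powr (- \<alpha>)" using assms by simp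
      then have "1 - 1 / (1 + \<rho>) \<le> 1 - 1 / (1 + \<rho> * norm x powr (- \<alpha>))"
        using assms by (intro diff_mono frac_le) auto
      also note gamma_shot_bounds(4)[OF assms(2,3)]
      also have "1 - 1 / (1 + \<rho>) = \<rho> / (1 + \<rho>)" using assms by (simp add: field_simps)
      finally show ?thesis using True by simp
    qed (use gamma_shot_bounds[OF assms(2,3)] in simp)
  qed
  then have "(\<integral>x. indicator (ball 0 1) x * (\<rho> / (1 + \<rho>)) \<partial>(lborel :: (real^2) measure)) \<le> shot_exponent \<alpha> \<rho> m"
    unfolding shot_exponent_def using emeasure_lborel_ball_finite[of "0 :: real^2" 1]
    by (intro integral_mono_AE gamma_shot_integrable assms integrable_mult_left integrable_real_indicator) auto
  then show ?thesis by (simp add: mult.commute)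
qed

lemma shot_exponent_pos:
  assumes "2 < \<alpha>" "0 < \<rho>" "1 \<le> m"
  shows "0 < shot_exponent \<alpha> \<rho> m"
  using shot_exponent_lower[OF assms] content_ball_pos[of 1 "0 :: real^2"] assms
  by (smt (verit) divide_pos_pos mult_pos_pos measure_completion sets_borel borel_open open_ball)

text \<open>Dilating the plane by \<open>c = s powr (1 / \<alpha>)\<close> divides the path loss by
  \<open>s\<close> and so absorbs the factor \<open>s\<close>; the Jacobian is
  \<open>c\<^sup>2\<close>. This is the origin of every exponent \<open>2 / \<alpha>\<close>
  below.\<close>

lemma shot_exponent_scale:
  assumes "2 < \<alpha>" "0 < s"
  shows "shot_exponent \<alpha> (\<rho> * s) m = s powr (2 / \<alpha>) * shot_exponent \<alpha> \<rho> m"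
proof -
  define c where "c = s powr (1 / \<alpha>)"
  have c: "0 < c" using assms by (simp add: c_def)
  have c2: "c\<^sup>2 = s powr (2 / \<alpha>)" using assms by (simp add: c_def powr_power)
  have scale: "gamma_shot \<alpha> (\<rho> * s) m (0 + c *\<^sub>R x) = gamma_shot \<alpha> \<rho> m x" for x
    using assms by (simp add: gamma_shot_def c_def powr_mult powr_powr powr_minus field_simps)
  have "shot_exponent \<alpha> (\<rho> * s) m =
     (\<integral>x. gamma_shot \<alpha> (\<rho> * s) m x \<partial>density (distr lborel borel (\<lambda>x. 0 + c *\<^sub>R x)) (\<lambda>_. \<bar>c\<bar>^DIM(real^2)))"
    unfolding shot_exponent_def by (subst lborel_affine[of c "0 :: real^2"]) (use c in auto)
  also have "\<dots> = (\<integral>x. c\<^sup>2 * gamma_shot \<alpha> \<rho> m x \<partial>lborel)"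
    using c by (simp add: ennreal_power integral_density integral_distr scale[simplified])
  finally show ?thesis by (simp add: shot_exponent_def c2)
qed

section \<open>The interference of a stream\<close>

definition interference ::
  "real \<Rightarrow> (nat \<Rightarrow> 'a \<Rightarrow> real^2) \<Rightarrow> (nat \<Rightarrow> 'a \<Rightarrow> real) \<Rightarrow> 'a \<Rightarrow> real" where
  "interference \<alpha> X \<Psi> \<omega> = (\<Sum>l. norm (X l \<omega>) powr (- \<alpha>) * \<Psi> l \<omega>)"

text \<open>Partial sums of a divergent nonnegative series tend to infinity, so the limit exists in
  either case. This permits passing to the limit in Laplace transforms before the interference is
  known to converge.\<close>

lemma LIMSEQ_exp_partial_sums:
  fixes b :: "nat \<Rightarrow> real"
  assumes b: "\<And>l. 0 \<le> b l" and "0 < s"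
  shows "(\<lambda>m. exp (- (s * (\<Sum>l<m. b l)))) \<longlonglongrightarrow> (if summable b then exp (- (s * suminf b)) else 0)"
proof (cases "summable b")
  case True
  then show ?thesis by (simp add: tendsto_exp tendsto_minus tendsto_mult_left summable_LIMSEQ)
next
  case False
  have inc: "incseq (\<lambda>m. \<Sum>l<m. b l)" using b by (intro incseq_SucI) simp
  have "filterlim (\<lambda>m. \<Sum>l<m. b l) at_top sequentially"
    unfolding filterlim_at_top
  proof
    fix B
    obtain m where "B < (\<Sum>l<m. b l)"
      using False summableI_nonneg_bounded[of b B] b by (meson not_le)
    then show "\<forall>\<^sub>F m in sequentially. B \<le> (\<Sum>l<m. b l)"
      unfolding eventually_sequentially using incseqD[OF inc] by (meson less_imp_le order_trans)
  qed
  then have "filterlim (\<lambda>m. s * (\<Sum>l<m. b l)) at_top sequentially"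
    using \<open>0 < s\<close> filterlim_tendsto_pos_mult_at_top[OF tendsto_const] by blast
  then have "filterlim (\<lambda>m. - (s * (\<Sum>l<m. b l))) at_bot sequentially"
    by (simp add: filterlim_uminus_at_top)
  then show ?thesis using False filterlim_compose[OF exp_at_bot] by simp
qed

text \<open>The product formula is applied to the whole sequence up to index \<open>m + 1\<close>,
  with the constant factor 1 attached to \<open>W\<close>.\<close>

lemma (in prob_space) indep_vars_nn_integral_marks:
  fixes W Y :: "'a \<Rightarrow> real" and \<Psi> :: "nat \<Rightarrow> 'a \<Rightarrow> real" and k0 :: "real \<Rightarrow> ennreal"
  assumes ind: "indep_vars (\<lambda>_. borel) (case_nat W (case_nat Y \<Psi>)) UNIV"
    and k0: "k0 \<in> borel_measurable borel" and k: "\<And>l. k l \<in> borel_measurable borel"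
  shows "(\<integral>\<^sup>+\<omega>. k0 (Y \<omega>) * (\<Prod>l<m. k l (\<Psi> l \<omega>)) \<partial>M) =
    (\<integral>\<^sup>+\<omega>. k0 (Y \<omega>) \<partial>M) * (\<Prod>l<m. \<integral>\<^sup>+\<omega>. k l (\<Psi> l \<omega>) \<partial>M)"
proof -
  let ?Z = "case_nat W (case_nat Y \<Psi>)" and ?k = "case_nat (\<lambda>_. 1) (case_nat k0 k)"
  let ?I = "{..<Suc (Suc m)}"
  have "?k i \<in> borel_measurable borel" for i
    using k0 k by (auto split: nat.split)
  then have "indep_vars (\<lambda>_. borel) (\<lambda>i \<omega>. ?k i (?Z i \<omega>)) ?I"
    by (intro indep_vars_compose2[OF indep_vars_subset[OF ind]]) auto
  then have "(\<integral>\<^sup>+\<omega>. (\<Prod>i\<in>?I. ?k i (?Z i \<omega>)) \<partial>M) = (\<Prod>i\<in>?I. \<integral>\<^sup>+\<omega>. ?k i (?Z i \<omega>) \<partial>M)"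
    by (intro indep_vars_nn_integral) auto
  then show ?thesis
    by (simp add: prod.lessThan_Suc_shift emeasure_space_1 del: prod.lessThan_Suc)
qed

lemma (in prob_space) gamma_AE_nonneg:
  assumes "gamma_distributed M Z v \<theta>"
  shows "AE \<omega> in M. 0 \<le> Z \<omega>"
  using assms unfolding gamma_distributed_def
  by (subst distributed_AE2) (auto simp: erlang_density_def)

text \<open>One intensity at a time: two intensities are two instances over the same
  \<open>P\<close>, \<open>W\<close> and \<open>Y\<close>, with no relation between their points or
  marks.\<close>

locale stream =
  fixes rcv :: receiver and \<alpha> \<rho> r :: real and N M :: nat and \<mu> :: real and P :: "'a measure"
    and X :: "nat \<Rightarrow> 'a \<Rightarrow> real^2" and \<Psi> :: "nat \<Rightarrow> 'a \<Rightarrow> real" and W Y :: "'a \<Rightarrow> real"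
  assumes model: "stream_model rcv \<alpha> \<rho> r N M \<mu> P X \<Psi> W Y"
    and alpha: "2 < \<alpha>" and rho: "0 < \<rho>" and r: "0 < r" and mu: "0 < \<mu>"
    and M: "1 \<le> M" "M \<le> N"
begin

sublocale prob_space P
  using model by (simp add: stream_model_def)

lemma ppp: "homogeneous_PPP P \<mu> X"
  using model by (simp add: stream_model_def)

lemma indep_real: "indep_vars (\<lambda>_. borel) (case_nat W (case_nat Y \<Psi>)) UNIV"
  using model by (simp add: stream_model_def)

lemma indep_point_real: "indep_set
   (sets (vimage_algebra (space P) (\<lambda>\<omega> l. X l \<omega>) (\<Pi>\<^sub>M l\<in>UNIV. borel)))
   (sets (vimage_algebra (space P) (\<lambda>\<omega> i. case_nat W (case_nat Y \<Psi>) i \<omega>) (\<Pi>\<^sub>M i\<in>UNIV. borel)))"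
  using model by (simp add: stream_model_def)

lemma X_measurable [measurable]: "X l \<in> borel_measurable P"
  using ppp by (simp add: homogeneous_PPP_def)

lemma real_measurable: "case_nat W (case_nat Y \<Psi>) i \<in> borel_measurable P"
  using indep_real by (auto simp: indep_vars_def)

lemma W_measurable [measurable]: "W \<in> borel_measurable P"
  using real_measurable[of 0] by simp

lemma Y_measurable [measurable]: "Y \<in> borel_measurable P"
  using real_measurable[of 1] by simp

lemma Psi_measurable [measurable]: "\<Psi> l \<in> borel_measurable P"
  using real_measurable[of "Suc (Suc l)"] by simp

lemma points_measurable: "(\<lambda>\<omega> l. X l \<omega>) \<in> measurable P (\<Pi>\<^sub>M l\<in>UNIV. borel)"
  by (intro measurable_PiM_single') (simp_all add: PiE_UNIV_domain)

lemma reals_measurable: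
  "(\<lambda>\<omega> i. case_nat W (case_nat Y \<Psi>) i \<omega>) \<in> measurable P (\<Pi>\<^sub>M i\<in>UNIV. borel)"
  by (intro measurable_PiM_single' real_measurable) (simp_all add: PiE_UNIV_domain)

lemma Psi_gamma: "gamma_distributed P (\<Psi> l) M (\<rho> / M)"
  using model by (simp add: stream_model_def)

lemma Psi_nonneg: "AE \<omega> in P. \<forall>l. 0 \<le> \<Psi> l \<omega>"
  using gamma_AE_nonneg[OF Psi_gamma] by (simp add: AE_all_countable)

lemma Y_nonneg: "AE \<omega> in P. 0 \<le> Y \<omega>"
proof (cases "rcv = ZF \<or> M = 1")
  case True
  then have "AE \<omega> in P. Y \<omega> = 0"
    using model by (cases rcv) (auto simp: stream_model_def)
  then show ?thesis by auto
next
  case False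
  then have "gamma_distributed P Y (M - 1) (\<rho> / (M * r powr \<alpha>))"
    using model by (cases rcv) (auto simp: stream_model_def)
  then show ?thesis by (rule gamma_AE_nonneg)
qed

lemma summable_measurable [measurable]:
  "Measurable.pred P (\<lambda>\<omega>. summable (\<lambda>l. norm (X l \<omega>) powr (- \<alpha>) * \<Psi> l \<omega>))"
  unfolding pred_def summable_iff_convergent Cauchy_convergent_iff[symmetric]
  by (rule sets_Collect_Cauchy) measurable

lemma interference_measurable [measurable]: "interference \<alpha> X \<Psi> \<in> borel_measurable P"
  unfolding interference_def[abs_def] by measurable

text \<open>With the points held fixed, the marks and \<open>Y\<close> are independent, and the mark
  at \<open>x\<close> contributes \<open>1 - gamma_shot \<alpha> (\<rho> * s) M x\<close>. What
  remains is a functional of the points alone.\<close>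

lemma laplace_partial_sum:
  assumes "0 \<le> t" "0 < s"
  shows "(\<integral>\<^sup>+\<omega>. ennreal (exp (- (t * Y \<omega>)) * exp (- (s * (\<Sum>l<m. norm (X l \<omega>) powr (- \<alpha>) * \<Psi> l \<omega>)))) \<partial>P) =
    (\<integral>\<^sup>+\<omega>. ennreal (exp (- (t * Y \<omega>))) \<partial>P) *
    (\<integral>\<^sup>+\<omega>. (\<Prod>l<m. ennreal (1 - gamma_shot \<alpha> (\<rho> * s) M (X l \<omega>))) \<partial>P)"
proof -
  define c where "c = (\<integral>\<^sup>+\<omega>. ennreal (exp (- (t * Y \<omega>))) \<partial>P)"
  define f where "f p = ennreal (exp (- (t * snd p 1))) *
      (\<Prod>l<m. ennreal (exp (- (s * norm (fst p l) powr (- \<alpha>) * snd p (Suc (Suc l))))))"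
    for p :: "(nat \<Rightarrow> real^2) \<times> (nat \<Rightarrow> real)"
  note [measurable] = measurable_fst_component measurable_snd_component
  have f: "f \<in> borel_measurable ((\<Pi>\<^sub>M l\<in>UNIV. borel) \<Otimes>\<^sub>M (\<Pi>\<^sub>M i\<in>UNIV. borel))"
    unfolding f_def by measurable
  have inner: "(\<integral>\<^sup>+\<omega>'. f (x, \<lambda>i. case_nat W (case_nat Y \<Psi>) i \<omega>') \<partial>P) =
      c * (\<Prod>l<m. ennreal (1 - gamma_shot \<alpha> (\<rho> * s) M (x l)))" for x
  proof -
    have "(\<integral>\<^sup>+\<omega>'. f (x, \<lambda>i. case_nat W (case_nat Y \<Psi>) i \<omega>') \<partial>P) =
       c * (\<Prod>l<m. \<integral>\<^sup>+\<omega>. ennreal (exp (- (s * norm (x l) powr (- \<alpha>) * \<Psi> l \<omega>))) \<partial>P)"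
      unfolding f_def c_def fst_conv snd_conv
      using indep_vars_nn_integral_marks[OF indep_real, of "\<lambda>y. ennreal (exp (- (t * y)))"
        "\<lambda>l z. ennreal (exp (- (s * norm (x l) powr (- \<alpha>) * z)))" m] by simp
    also have "\<dots> = c * (\<Prod>l<m. ennreal (1 - gamma_shot \<alpha> (\<rho> * s) M (x l)))"
      using assms rho M
      by (subst gamma_laplace[OF Psi_gamma]) (auto simp: gamma_shot_def mult_ac)
    finally show ?thesis .
  qed
  have "(\<integral>\<^sup>+\<omega>. ennreal (exp (- (t * Y \<omega>)) * exp (- (s * (\<Sum>l<m. norm (X l \<omega>) powr (- \<alpha>) * \<Psi> l \<omega>)))) \<partial>P) =
      (\<integral>\<^sup>+\<omega>. f (\<lambda>l. X l \<omega>, \<lambda>i. case_nat W (case_nat Y \<Psi>) i \<omega>) \<partial>P)"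
    by (intro nn_integral_cong)
      (simp add: f_def prod_ennreal exp_sum[symmetric] ennreal_mult sum_distrib_left sum_negf mult_ac)
  also have "\<dots> = (\<integral>\<^sup>+\<omega>. c * (\<Prod>l<m. ennreal (1 - gamma_shot \<alpha> (\<rho> * s) M (X l \<omega>))) \<partial>P)"
    by (subst indep_set_nn_integral[OF points_measurable reals_measurable indep_point_real f]) (simp only: inner)
  also have "\<dots> = c * (\<integral>\<^sup>+\<omega>. (\<Prod>l<m. ennreal (1 - gamma_shot \<alpha> (\<rho> * s) M (X l \<omega>))) \<partial>P)"
    by (rule nn_integral_cmult) measurable
  finally show ?thesis unfolding c_def .
qed

text \<open>
  Where the interference series diverges, \<open>interference\<close> has a junk value; the exponential is
  replaced by 0 there, the value for infinite interference.
\<close>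
lemma laplace_extended:
  assumes "0 \<le> t" "0 < s"
  shows "(\<integral>\<^sup>+\<omega>. ennreal (exp (- (t * Y \<omega>)) * (if summable (\<lambda>l. norm (X l \<omega>) powr (- \<alpha>) * \<Psi> l \<omega>)
       then exp (- (s * interference \<alpha> X \<Psi> \<omega>)) else 0)) \<partial>P) =
    (\<integral>\<^sup>+\<omega>. ennreal (exp (- (t * Y \<omega>))) \<partial>P) *
      ennreal (exp (- (\<mu> * (s powr (2 / \<alpha>) * shot_exponent \<alpha> \<rho> M))))"
    (is "?L = ?c * ?R")
\<comment> \<open>Both sides are limits of the transforms with partial sums: the left by dominated
  convergence, the right by monotone convergence of the products over the points and the Laplace
  functional.\<close>
proof (rule LIMSEQ_unique)
  let ?D = "\<lambda>m \<omega>. exp (- (t * Y \<omega>)) * exp (- (s * (\<Sum>l<m. norm (X l \<omega>) powr (- \<alpha>) * \<Psi> l \<omega>)))"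
  let ?G = "\<lambda>m \<omega>. \<Prod>l<m. ennreal (1 - gamma_shot \<alpha> (\<rho> * s) M (X l \<omega>))"
  have rs: "0 < \<rho> * s" using rho assms by simp
  show "(\<lambda>m. \<integral>\<^sup>+\<omega>. ennreal (?D m \<omega>) \<partial>P) \<longlonglongrightarrow> ?L"
  proof (rule nn_integral_dominated_convergence[where w = "\<lambda>_. 1"])
    show "AE \<omega> in P. ennreal (?D m \<omega>) \<le> 1" for m
      using Psi_nonneg Y_nonneg
    proof eventually_elim
      case (elim \<omega>)
      have "?D m \<omega> \<le> 1 * 1"
        using elim assms by (intro mult_mono) (auto intro!: sum_nonneg mult_nonneg_nonneg)
      then show ?case by simp
    qed
    show "AE \<omega> in P. (\<lambda>m. ennreal (?D m \<omega>)) \<longlonglongrightarrow> ennreal (exp (- (t * Y \<omega>)) *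
        (if summable (\<lambda>l. norm (X l \<omega>) powr (- \<alpha>) * \<Psi> l \<omega>) then exp (- (s * interference \<alpha> X \<Psi> \<omega>)) else 0))"
      using Psi_nonneg
    proof eventually_elim
      case (elim \<omega>)
      then show ?case
        unfolding interference_def using assms
        by (intro tendsto_ennrealI tendsto_mult tendsto_const LIMSEQ_exp_partial_sums) auto
    qed
  qed (auto simp: emeasure_space_1)
  have dec: "decseq ?G"
  proof (intro decseq_SucI le_funI)
    fix m \<omega>
    have "?G m \<omega> * ennreal (1 - gamma_shot \<alpha> (\<rho> * s) M (X m \<omega>)) \<le> ?G m \<omega> * 1"
      using gamma_shot_bounds(1)[OF rs M(1)] by (intro mult_left_mono) auto
    then show "?G (Suc m) \<omega> \<le> ?G m \<omega>" by simp
  qed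
  have "(INF m. \<integral>\<^sup>+\<omega>. ?G m \<omega> \<partial>P) = (\<integral>\<^sup>+\<omega>. (INF m. ?G m \<omega>) \<partial>P)"
    by (rule nn_integral_monotone_convergence_INF_decseq[OF dec, of _ 0, symmetric])
      (auto simp: emeasure_space_1)
  also have "\<dots> = ennreal (exp (- (\<mu> * shot_exponent \<alpha> (\<rho> * s) M)))"
    unfolding shot_exponent_def
    by (intro homogeneous_PPP_laplace_functional[OF prob_space_axioms ppp mu]
        gamma_shot_measurable gamma_shot_integrable gamma_shot_bounds alpha rs M)
  also have "\<dots> = ?R" using alpha assms by (simp add: shot_exponent_scale)
  finally have "(INF m. \<integral>\<^sup>+\<omega>. ?G m \<omega> \<partial>P) = ?R" .
  moreover have "decseq (\<lambda>m. \<integral>\<^sup>+\<omega>. ?G m \<omega> \<partial>P)"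
    by (intro decseq_SucI nn_integral_mono le_funD[OF decseq_SucD[OF dec]])
  ultimately have "(\<lambda>m. \<integral>\<^sup>+\<omega>. ?G m \<omega> \<partial>P) \<longlonglongrightarrow> ?R"
    using LIMSEQ_INF by metis
  moreover have "?c \<le> (\<integral>\<^sup>+\<omega>. 1 \<partial>P)"
    by (intro nn_integral_mono_AE, use Y_nonneg in eventually_elim) (use assms in auto)
  then have "?c < top" by (simp add: emeasure_space_1 order.strict_trans1)
  ultimately show "(\<lambda>m. \<integral>\<^sup>+\<omega>. ennreal (?D m \<omega>) \<partial>P) \<longlonglongrightarrow> ?c * ?R"
    unfolding laplace_partial_sum[OF assms] by (intro ennreal_tendsto_cmult)
qed

text \<open>As \<open>s\<close> tends to 0, the right-hand side of the previous identity for \<open>t = 0\<close> tends to 1.\<close>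
lemma AE_summable: "AE \<omega> in P. summable (\<lambda>l. norm (X l \<omega>) powr (- \<alpha>) * \<Psi> l \<omega>)"
proof -
  let ?S = "{\<omega> \<in> space P. summable (\<lambda>l. norm (X l \<omega>) powr (- \<alpha>) * \<Psi> l \<omega>)}"
  have [measurable]: "?S \<in> events" by measurable
  let ?K = "shot_exponent \<alpha> \<rho> M"
  have le: "exp (- (\<mu> * (s powr (2 / \<alpha>) * ?K))) \<le> prob ?S" if "0 < s" for s
  proof -
    have "ennreal (exp (- (\<mu> * (s powr (2 / \<alpha>) * ?K)))) =
      (\<integral>\<^sup>+\<omega>. ennreal (if summable (\<lambda>l. norm (X l \<omega>) powr (- \<alpha>) * \<Psi> l \<omega>)
       then exp (- (s * interference \<alpha> X \<Psi> \<omega>)) else 0) \<partial>P)"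
      using laplace_extended[of 0 s] that by (simp add: emeasure_space_1)
    also have "\<dots> \<le> (\<integral>\<^sup>+\<omega>. indicator ?S \<omega> \<partial>P)"
    proof (rule nn_integral_mono_AE, use Psi_nonneg AE_space in eventually_elim)
      case (elim \<omega>)
      then show ?case
        using that by (auto simp: interference_def split: split_indicator
          intro!: suminf_nonneg mult_nonneg_nonneg)
    qed
    finally show ?thesis by (simp add: emeasure_eq_measure)
  qed
  have "((\<lambda>s. exp (- (\<mu> * (s powr (2 / \<alpha>) * ?K)))) \<longlongrightarrow> exp (- (\<mu> * (0 powr (2 / \<alpha>) * ?K)))) (at_right 0)"
    using alpha by (intro tendsto_intros) (auto simp: eventually_at_right_less intro: eventually_at_rightI[of 0 1])
  then have "exp (- (\<mu> * (0 powr (2 / \<alpha>) * ?K))) \<le> prob ?S"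
    by (rule tendsto_upperbound) (use le in \<open>auto intro: eventually_at_rightI[of 0 1]\<close>)
  then have "prob ?S = 1" using prob_le_1[of ?S] by simp
  then show ?thesis by (subst (asm) prob_Collect_eq_1) simp_all
qed

lemma interference_nonneg: "AE \<omega> in P. 0 \<le> interference \<alpha> X \<Psi> \<omega>"
  using AE_summable Psi_nonneg by eventually_elim (auto simp: interference_def intro!: suminf_nonneg)

text \<open>Separate parameters \<open>t\<close> and \<open>s\<close> are kept because a change of
  intensity rescales the interference but leaves \<open>Y\<close> alone.\<close>

lemma laplace:
  assumes "0 \<le> t" "0 < s"
  shows "expectation (\<lambda>\<omega>. exp (- (t * Y \<omega> + s * interference \<alpha> X \<Psi> \<omega>))) =
    expectation (\<lambda>\<omega>. exp (- (t * Y \<omega>))) * exp (- (\<mu> * (s powr (2 / \<alpha>) * shot_exponent \<alpha> \<rho> M)))"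
proof -
  have "AE \<omega> in P. norm (exp (- (t * Y \<omega>))) \<le> 1" using Y_nonneg by eventually_elim (use assms in auto)
  then have int: "integrable P (\<lambda>\<omega>. exp (- (t * Y \<omega>)))" by (rule integrable_const_bound) measurable
  have "(\<integral>\<^sup>+\<omega>. ennreal (exp (- (t * Y \<omega> + s * interference \<alpha> X \<Psi> \<omega>))) \<partial>P) =
    (\<integral>\<^sup>+\<omega>. ennreal (exp (- (t * Y \<omega>)) * (if summable (\<lambda>l. norm (X l \<omega>) powr (- \<alpha>) * \<Psi> l \<omega>)
       then exp (- (s * interference \<alpha> X \<Psi> \<omega>)) else 0)) \<partial>P)"
    by (rule nn_integral_cong_AE, use AE_summable in eventually_elim) (simp add: exp_add[symmetric])
  also have "\<dots> = ennreal (expectation (\<lambda>\<omega>. exp (- (t * Y \<omega>)))) *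
      ennreal (exp (- (\<mu> * (s powr (2 / \<alpha>) * shot_exponent \<alpha> \<rho> M))))"
    unfolding laplace_extended[OF assms] by (subst nn_integral_eq_integral[OF int]) auto
  finally show ?thesis
    by (subst integral_eq_nn_integral) (auto simp: ennreal_mult[symmetric] integral_nonneg)
qed

lemma laplace_interference:
  "0 < s \<Longrightarrow> expectation (\<lambda>\<omega>. exp (- (s * interference \<alpha> X \<Psi> \<omega>))) =
    exp (- (\<mu> * (s powr (2 / \<alpha>) * shot_exponent \<alpha> \<rho> M)))"
  using laplace[of 0 s] by (simp add: prob_space)

end

section \<open>The outage probability as a function of the intensity\<close>

text \<open>
  Weierstrass approximation on the compact interval containing \<open>exp (- U)\<close> and \<open>exp (- V)\<close>
  takes the place of the uniqueness theorem for Laplace transforms.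
\<close>
lemma (in prob_space) expectation_exp_eq_of_moments:
  fixes U V :: "'a \<Rightarrow> real" and q :: "real \<Rightarrow> real"
  assumes [measurable]: "U \<in> borel_measurable M" "V \<in> borel_measurable M"
    and nn: "AE \<omega> in M. 0 \<le> U \<omega>" "AE \<omega> in M. 0 \<le> V \<omega>"
    and mom: "\<And>k. (0::nat) < k \<Longrightarrow> expectation (\<lambda>\<omega>. exp (- (k * U \<omega>))) = expectation (\<lambda>\<omega>. exp (- (k * V \<omega>)))"
    and q: "continuous_on {0..1} q" and [measurable]: "q \<in> borel_measurable borel"
  shows "expectation (\<lambda>\<omega>. q (exp (- U \<omega>))) = expectation (\<lambda>\<omega>. q (exp (- V \<omega>)))"
proof -
  have in01: "AE \<omega> in M. exp (- U \<omega>) \<in> {0..1}" "AE \<omega> in M. exp (- V \<omega>) \<in> {0..1}"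
    using nn by (auto elim!: eventually_mono)
  have "compact (q ` {0..1})" by (rule compact_continuous_image[OF q]) simp
  then obtain B where B: "\<And>t. t \<in> {0..1} \<Longrightarrow> \<bar>q t\<bar> \<le> B"
    using compact_imp_bounded bounded_iff by (metis image_eqI real_norm_def)
  have q_int: "integrable M (\<lambda>\<omega>. q (exp (- Z \<omega>)))"
    if [measurable]: "Z \<in> borel_measurable M" and "AE \<omega> in M. exp (- Z \<omega>) \<in> {0..1}" for Z :: "'a \<Rightarrow> real"
    by (rule integrable_const_bound[of _ B]) (use that B in auto)
  have pow_int: "integrable M (\<lambda>\<omega>. exp (- Z \<omega>) ^ k)"
    if [measurable]: "Z \<in> borel_measurable M" and "AE \<omega> in M. exp (- Z \<omega>) \<in> {0..1}" for Z :: "'a \<Rightarrow> real" and k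
  proof (rule integrable_const_bound[of _ 1])
    show "AE \<omega> in M. norm (exp (- Z \<omega>) ^ k) \<le> 1"
      using that(2) by eventually_elim (auto intro: power_le_one)
  qed measurable
  \<comment> \<open>The moments are given for positive \<open>k\<close> only, matching
    \<open>0 < s\<close> in the Laplace transform; for \<open>k = 0\<close> both sides are
    1.\<close>
  have pow: "expectation (\<lambda>\<omega>. exp (- U \<omega>) ^ k) = expectation (\<lambda>\<omega>. exp (- V \<omega>) ^ k)" for k
    using mom[of k] by (cases "k = 0") (simp_all add: exp_of_nat_mult[symmetric])
  have close: "\<bar>expectation (\<lambda>\<omega>. q (exp (- U \<omega>))) - expectation (\<lambda>\<omega>. q (exp (- V \<omega>)))\<bar> \<le> e" if e: "0 < e" for e
  proof -
    obtain p where p: "real_polynomial_function p" "\<And>t. t \<in> {0..1} \<Longrightarrow> \<bar>q t - p t\<bar> < e / 2"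
      by (rule Stone_Weierstrass_real_polynomial_function[of "{0..1}" q "e / 2"]) (use q e in auto)
    then obtain a n where p_eq: "p = (\<lambda>x. \<Sum>i\<le>n. a i * x ^ i)"
      using real_polynomial_function_iff_sum by auto
    have p_int: "integrable M (\<lambda>\<omega>. p (exp (- Z \<omega>)))"
      if "Z \<in> borel_measurable M" "AE \<omega> in M. exp (- Z \<omega>) \<in> {0..1}" for Z :: "'a \<Rightarrow> real"
      unfolding p_eq by (intro Bochner_Integration.integrable_sum integrable_mult_right pow_int that)
    have near: "\<bar>expectation (\<lambda>\<omega>. q (exp (- Z \<omega>))) - expectation (\<lambda>\<omega>. p (exp (- Z \<omega>)))\<bar> \<le> e / 2"
      if Z: "Z \<in> borel_measurable M" "AE \<omega> in M. exp (- Z \<omega>) \<in> {0..1}" for Z :: "'a \<Rightarrow> real"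
    proof -
      have "\<bar>expectation (\<lambda>\<omega>. q (exp (- Z \<omega>)) - p (exp (- Z \<omega>)))\<bar> \<le>
          expectation (\<lambda>\<omega>. \<bar>q (exp (- Z \<omega>)) - p (exp (- Z \<omega>))\<bar>)"
        by (rule integral_abs_bound)
      also have "\<dots> \<le> expectation (\<lambda>\<omega>. e / 2)"
        by (intro integral_mono_AE integrable_abs Bochner_Integration.integrable_diff q_int p_int Z)
           (use Z(2) p(2) in \<open>auto elim!: eventually_mono intro!: less_imp_le\<close>)
      finally show ?thesis
        by (simp add: prob_space Bochner_Integration.integral_diff[OF q_int[OF Z] p_int[OF Z]])
    qed
    have "expectation (\<lambda>\<omega>. p (exp (- U \<omega>))) = expectation (\<lambda>\<omega>. p (exp (- V \<omega>)))"
      unfolding p_eq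
      by (subst (1 2) Bochner_Integration.integral_sum) (use in01 in \<open>auto intro!: pow_int simp: pow\<close>)
    then show ?thesis
      using near[OF assms(1) in01(1)] near[OF assms(2) in01(2)] by linarith
  qed
  have "\<bar>expectation (\<lambda>\<omega>. q (exp (- U \<omega>))) - expectation (\<lambda>\<omega>. q (exp (- V \<omega>)))\<bar> \<le> 0"
    by (rule field_le_epsilon) (simp add: close)
  then show ?thesis by simp
qed

text \<open>The density is positive on the open half-line, so an interval starting at or above 0
  carries positive mass.\<close>

lemma (in prob_space) gamma_cdf_strict_mono:
  assumes Z: "gamma_distributed M Z v \<theta>" and "0 < \<theta>" "0 \<le> x" "x < y"
  shows "cdf (distr M borel Z) x < cdf (distr M borel Z) y"
proof -
  let ?f = "\<lambda>t. ennreal (erlang_density (v - 1) (1 / \<theta>) t)"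
  have D: "distributed M lborel Z ?f" using Z by (simp add: gamma_distributed_def)
  then have [measurable]: "Z \<in> borel_measurable M" using distributed_measurable by fastforce
  interpret D: real_distribution "distr M borel Z" by (rule real_distribution_distr) simp
  have "emeasure M (Z -` {x<..y} \<inter> space M) = (\<integral>\<^sup>+t. ?f t * indicator {x<..y} t \<partial>lborel)"
    by (rule distributed_emeasure[OF D]) simp
  moreover have "(\<integral>\<^sup>+t. ?f t * indicator {x<..y} t \<partial>lborel) \<noteq> 0"
  proof
    assume "(\<integral>\<^sup>+t. ?f t * indicator {x<..y} t \<partial>lborel) = 0"
    then have "AE t in lborel. ?f t * indicator {x<..y} t = 0"
      by (subst (asm) nn_integral_0_iff_AE) auto
    then have "AE t in lborel. t \<notin> {x<..y}"
    proof eventually_elim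
      case (elim t)
      have "0 < erlang_density (v - 1) (1 / \<theta>) t" if "0 < t"
        using that \<open>0 < \<theta>\<close> by (simp add: erlang_density_def)
      then show ?case
        using elim \<open>0 \<le> x\<close> by (auto simp: ennreal_eq_0_iff not_le split: split_indicator_asm)
    qed
    then have "emeasure lborel {x<..y} = 0"
      by (subst (asm) AE_iff_measurable[of "{x<..y}"]) auto
    then show False using assms by simp
  qed
  ultimately have "emeasure M (Z -` {x<..y} \<inter> space M) \<noteq> 0" by simp
  then have "prob (Z -` {x<..y} \<inter> space M) > 0"
    by (simp add: emeasure_eq_measure zero_less_measure_iff)
  then show ?thesis
    using D.cdf_diff_eq[OF \<open>x < y\<close>] by (simp add: measure_distr)
qed

lemma (in prob_space) gamma_cdf_isCont:
  assumes Z: "gamma_distributed M Z v \<theta>"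
  shows "isCont (cdf (distr M borel Z)) x"
proof -
  let ?f = "\<lambda>t. ennreal (erlang_density (v - 1) (1 / \<theta>) t)"
  have D: "distributed M lborel Z ?f" using Z by (simp add: gamma_distributed_def)
  then have [measurable]: "Z \<in> borel_measurable M" using distributed_measurable by fastforce
  interpret D: real_distribution "distr M borel Z" by (rule real_distribution_distr) simp
  have "emeasure M (Z -` {x} \<inter> space M) = (\<integral>\<^sup>+t. ?f t * indicator {x} t \<partial>lborel)"
    by (rule distributed_emeasure[OF D]) simp
  also have "\<dots> = 0"
    using AE_lborel_singleton[of x] by (subst nn_integral_0_iff_AE) (auto elim: eventually_mono)
  finally show ?thesis
    by (simp add: D.isCont_cdf measure_distr emeasure_eq_measure)
qed

context stream
begin

text \<open>The probability of \<open>interference \<alpha> X \<Psi> \<omega> \<le> 0\<close> is at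
  most the Laplace transform at every \<open>s\<close>, which tends to 0 as \<open>s\<close> grows.
  Strictness is what makes the outage strictly increasing and drives it to 1.\<close>

lemma interference_pos: "AE \<omega> in P. 0 < interference \<alpha> X \<Psi> \<omega>"
proof -
  let ?I = "interference \<alpha> X \<Psi>" and ?K = "shot_exponent \<alpha> \<rho> M"
  let ?A = "{\<omega> \<in> space P. ?I \<omega> \<le> 0}"
  have K: "0 < ?K" by (rule shot_exponent_pos[OF alpha rho M(1)])
  have le: "prob ?A \<le> exp (- (\<mu> * (s powr (2 / \<alpha>) * ?K)))" if "0 < s" for s
  proof -
    have "prob ?A = expectation (indicator ?A)" by simp
    also have "\<dots> \<le> expectation (\<lambda>\<omega>. exp (- (s * ?I \<omega>)))"
    proof (rule integral_mono_AE)
      show "integrable P (\<lambda>\<omega>. exp (- (s * ?I \<omega>)))"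
        by (rule integrable_const_bound[of _ 1], use interference_nonneg in eventually_elim)
           (use that in auto)
      show "AE \<omega> in P. indicator ?A \<omega> \<le> exp (- (s * ?I \<omega>))"
        using interference_nonneg by eventually_elim (auto split: split_indicator)
    qed (simp add: less_top[symmetric])
    finally show ?thesis by (simp add: laplace_interference that)
  qed
  have "((\<lambda>s. exp (- (\<mu> * (s powr (2 / \<alpha>) * ?K)))) \<longlongrightarrow> 0) at_top"
    using alpha K mu by real_asymp
  then have "prob ?A \<le> 0"
    by (rule tendsto_lowerbound) (use le in \<open>auto intro: eventually_at_top_dense[THEN iffD2]\<close>)
  then have "prob ?A = 0" by (simp add: measure_le_0_iff)
  then have "AE \<omega> in P. \<not> ?I \<omega> \<le> 0" by (subst (asm) prob_Collect_eq_0) simp_all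
  then show ?thesis by (simp add: not_le)
qed

text \<open>This is the conditioning on everything but \<open>W\<close>: \<open>u\<close> reads the
  points and the real sequence without its head, so \<open>W\<close> is independent of
  \<open>U\<close> and integrates out to its distribution function. A general \<open>u\<close>
  covers both the noise-only ratio and the full interference.\<close>

lemma prob_ratio_le:
  assumes u: "u \<in> borel_measurable ((\<Pi>\<^sub>M l\<in>UNIV. borel) \<Otimes>\<^sub>M (\<Pi>\<^sub>M i\<in>UNIV. borel))"
    and U: "\<And>\<omega>. U \<omega> = u (\<lambda>l. X l \<omega>, \<lambda>i. case_nat Y \<Psi> i \<omega>)"
    and nonneg: "AE \<omega> in P. 0 \<le> U \<omega>"
  shows "prob {\<omega> \<in> space P. W \<omega> / (U \<omega> + 1) \<le> \<beta>} =
    expectation (\<lambda>\<omega>. cdf (distr P borel W) (\<beta> * (U \<omega> + 1)))"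
proof -
  let ?Z = "case_nat W (case_nat Y \<Psi>)" and ?F = "cdf (distr P borel W)"
  interpret D: real_distribution "distr P borel W" by (rule real_distribution_distr) simp
  have [measurable]: "?F \<in> borel_measurable borel"
    by (rule borel_measurable_mono) (auto intro!: monoI D.cdf_nondecreasing)
  have shift: "(\<lambda>p. (fst p, \<lambda>i. snd p (Suc i))) \<in>
      measurable ((\<Pi>\<^sub>M l\<in>UNIV. borel) \<Otimes>\<^sub>M (\<Pi>\<^sub>M i\<in>UNIV. borel))
        ((\<Pi>\<^sub>M l\<in>UNIV. borel) \<Otimes>\<^sub>M (\<Pi>\<^sub>M i\<in>UNIV. borel))"
    by (intro measurable_Pair measurable_fst measurable_PiM_single' measurable_snd_component)
      (simp_all add: PiE_UNIV_domain)
  have u': "(\<lambda>p. u (fst p, \<lambda>i. snd p (Suc i))) \<in>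
      borel_measurable ((\<Pi>\<^sub>M l\<in>UNIV. borel) \<Otimes>\<^sub>M (\<Pi>\<^sub>M i\<in>UNIV. borel))"
    by (rule measurable_compose[OF shift u])
  note measurable_snd_component[measurable] u'[measurable]
  define f where "f p = (if snd p 0 \<le> \<beta> * (u (fst p, \<lambda>i. snd p (Suc i)) + 1) then 1 else 0 :: ennreal)" for p
  define h where "h p = ennreal (?F (\<beta> * (u (fst p, \<lambda>i. snd p (Suc i)) + 1)))" for p
  have f: "f \<in> borel_measurable ((\<Pi>\<^sub>M l\<in>UNIV. borel) \<Otimes>\<^sub>M (\<Pi>\<^sub>M i\<in>UNIV. borel))"
    unfolding f_def by measurable
  have h: "h \<in> borel_measurable ((\<Pi>\<^sub>M l\<in>UNIV. borel) \<Otimes>\<^sub>M (\<Pi>\<^sub>M i\<in>UNIV. borel))"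
    unfolding h_def by measurable
  note fubini = indep_set_nn_integral[OF points_measurable reals_measurable indep_point_real]
  have inner: "(\<integral>\<^sup>+\<omega>. f (x, \<lambda>i. ?Z i \<omega>) \<partial>P) = (\<integral>\<^sup>+\<omega>. h (x, \<lambda>i. ?Z i \<omega>) \<partial>P)" for x
  proof -
    let ?ux = "\<lambda>z. u (x, z)"
    have ux[measurable]: "?ux \<in> borel_measurable (\<Pi>\<^sub>M i\<in>UNIV. borel)"
      by (rule measurable_compose[OF measurable_Pair1' u]) (simp add: space_PiM)
    have "(\<integral>\<^sup>+\<omega>. f (x, \<lambda>i. ?Z i \<omega>) \<partial>P) =
        (\<integral>\<^sup>+\<omega>. (\<lambda>p. if snd p \<le> \<beta> * (?ux (fst p) + 1) then 1 else 0) (\<lambda>i. ?Z (Suc i) \<omega>, ?Z 0 \<omega>) \<partial>P)"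
      by (simp add: f_def)
    also have "\<dots> = (\<integral>\<^sup>+\<omega>. (\<integral>\<^sup>+\<omega>'. (\<lambda>p. if snd p \<le> \<beta> * (?ux (fst p) + 1) then 1 else 0)
        (\<lambda>i. ?Z (Suc i) \<omega>, ?Z 0 \<omega>') \<partial>P) \<partial>P)"
      by (rule indep_vars_nn_integral_head[OF indep_real]) measurable
    also have "\<dots> = (\<integral>\<^sup>+\<omega>. h (x, \<lambda>i. ?Z i \<omega>) \<partial>P)"
    proof (rule nn_integral_cong)
      fix \<omega>
      let ?b = "\<beta> * (?ux (\<lambda>i. ?Z (Suc i) \<omega>) + 1)"
      have "(\<integral>\<^sup>+\<omega>'. (if W \<omega>' \<le> ?b then 1 else 0) \<partial>P) = (\<integral>\<^sup>+\<omega>'. indicator (W -` {..?b} \<inter> space P) \<omega>' \<partial>P)"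
        by (intro nn_integral_cong) (auto split: split_indicator)
      also have "\<dots> = ennreal (?F ?b)"
        by (simp add: emeasure_eq_measure cdf_def measure_distr)
      finally show "(\<integral>\<^sup>+\<omega>'. (\<lambda>p. if snd p \<le> \<beta> * (?ux (fst p) + 1) then 1 else 0)
        (\<lambda>i. ?Z (Suc i) \<omega>, ?Z 0 \<omega>') \<partial>P) = h (x, \<lambda>i. ?Z i \<omega>)"
        by (simp add: h_def)
    qed
    finally show ?thesis .
  qed
  have [measurable]: "U \<in> borel_measurable P"
    unfolding U
    using measurable_compose[OF measurable_Pair[OF points_measurable reals_measurable] u'] by simp
  have "ennreal (prob {\<omega> \<in> space P. W \<omega> / (U \<omega> + 1) \<le> \<beta>}) =
      (\<integral>\<^sup>+\<omega>. indicator {\<omega> \<in> space P. W \<omega> / (U \<omega> + 1) \<le> \<beta>} \<omega> \<partial>P)"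
    by (simp add: emeasure_eq_measure)
  also have "\<dots> = (\<integral>\<^sup>+\<omega>. f (\<lambda>l. X l \<omega>, \<lambda>i. ?Z i \<omega>) \<partial>P)"
  proof (rule nn_integral_cong_AE, use nonneg AE_space in eventually_elim)
    case (elim \<omega>)
    then show ?case
      by (simp add: f_def U[symmetric] divide_le_eq split: split_indicator)
  qed
  also have "\<dots> = (\<integral>\<^sup>+\<omega>. h (\<lambda>l. X l \<omega>, \<lambda>i. ?Z i \<omega>) \<partial>P)"
    \<comment> \<open>The points are split off from the integral of \<open>f\<close>,
      \<open>W\<close> is integrated out for fixed points, and the same splitting for
      \<open>h\<close> is read backwards.\<close>
    by (simp only: fubini[OF f] fubini[OF h] inner)
  also have "\<dots> = (\<integral>\<^sup>+\<omega>. ennreal (?F (\<beta> * (U \<omega> + 1))) \<partial>P)"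
    by (simp add: h_def U)
  also have "\<dots> = ennreal (expectation (\<lambda>\<omega>. ?F (\<beta> * (U \<omega> + 1))))"
    by (intro nn_integral_eq_integral integrable_const_bound[of _ 1])
       (auto simp: D.cdf_nonneg D.cdf_bounded_prob)
  finally show ?thesis
    by (subst (asm) ennreal_inj) (auto intro!: integral_nonneg simp: D.cdf_nonneg)
qed

end

text \<open>For \<open>t = exp (- u)\<close> the argument is \<open>\<beta> * (u + 1)\<close>, so
  \<open>q\<close> is the conditional outage probability as a function of \<open>exp (- u)\<close>.
  The value 1 at \<open>t = 0\<close> stands for infinite \<open>u\<close> and is the limit of the
  distribution function, which extends \<open>q\<close> continuously to the compact
  interval.\<close>

lemma (in real_distribution) cdf_exp_transform_continuous:
  assumes cont: "\<And>x. isCont (cdf M) x" and "0 < \<beta>"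
  defines "q \<equiv> \<lambda>t. if t \<le> 0 then 1 else cdf M (\<beta> * (1 - ln t))"
  shows "continuous_on {0..1} q"
  unfolding continuous_on_def
proof
  fix t :: real assume t: "t \<in> {0..1}"
  show "(q \<longlongrightarrow> q t) (at t within {0..1})"
  proof (cases "t = 0")
    case True
    have "LIM t at_right 0. \<beta> * (1 - ln t) :> at_top"
      using \<open>0 < \<beta>\<close> by real_asymp
    from filterlim_compose[OF cdf_lim_at_top_prob this]
    have "((\<lambda>t. cdf M (\<beta> * (1 - ln t))) \<longlongrightarrow> 1) (at_right 0)" .
    then have "(q \<longlongrightarrow> 1) (at_right 0)"
      by (rule Lim_transform_eventually) (auto simp: q_def intro!: eventually_at_rightI[of 0 1])
    then show ?thesis using True by (simp add: at_within_Icc_at_right q_def)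
  next
    case False
    then have "0 < t" using t by simp
    have "isCont (\<lambda>t. cdf M (\<beta> * (1 - ln t))) t"
      by (rule isCont_o2[OF _ cont]) (use \<open>0 < t\<close> in \<open>auto intro!: continuous_intros\<close>)
    then have "((\<lambda>t. cdf M (\<beta> * (1 - ln t))) \<longlongrightarrow> q t) (at t)"
      using \<open>0 < t\<close> by (simp add: isCont_def q_def)
    moreover have "\<forall>\<^sub>F s in at t. 0 < s"
      using \<open>0 < t\<close> by (intro order_tendstoD(1)[OF tendsto_ident_at])
    ultimately have "(q \<longlongrightarrow> q t) (at t)"
      by (elim Lim_transform_eventually) (auto elim!: eventually_mono simp: q_def)
    then show ?thesis by (rule tendsto_within_subset) simp
  qed
qed

section \<open>Outage probability with the interference multiplied by a deterministic factor\<close>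

context stream
begin

abbreviation "W_cdf \<equiv> cdf (distr P borel W)"

sublocale W_distr: real_distribution "distr P borel W"
  by (rule real_distribution_distr) simp

lemma W_gamma:
  "gamma_distributed P W (case rcv of MRC \<Rightarrow> N | ZF \<Rightarrow> N - M + 1) (\<rho> / (M * r powr \<alpha>))"
  using model by (cases rcv) (auto simp: stream_model_def)

lemma scale_pos: "0 < \<rho> / (M * r powr \<alpha>)"
  using rho r M by simp

lemma W_cdf_measurable [measurable]: "W_cdf \<in> borel_measurable borel"
  by (rule borel_measurable_mono) (auto intro!: monoI W_distr.cdf_nondecreasing)

lemma W_cdf_integrable:
  "U \<in> borel_measurable P \<Longrightarrow> integrable P (\<lambda>\<omega>. W_cdf (U \<omega>))"
  by (rule integrable_const_bound[of _ 1])
    (auto simp: W_distr.cdf_nonneg W_distr.cdf_bounded_prob)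

lemma prob_noise_le:
  "prob {\<omega> \<in> space P. W \<omega> / (Y \<omega> + 1) \<le> \<beta>} = expectation (\<lambda>\<omega>. W_cdf (\<beta> * (Y \<omega> + 1)))"
proof (rule prob_ratio_le[OF _ _ Y_nonneg])
  show "(\<lambda>p. snd p 0) \<in> borel_measurable ((\<Pi>\<^sub>M l\<in>UNIV. borel) \<Otimes>\<^sub>M (\<Pi>\<^sub>M i\<in>UNIV. borel))"
    by (rule measurable_snd_component)
qed simp

lemma outage_prob_eq:
  "outage_prob P \<alpha> X \<Psi> W Y \<beta> =
    expectation (\<lambda>\<omega>. W_cdf (\<beta> * (Y \<omega> + interference \<alpha> X \<Psi> \<omega> + 1)))"
proof -
  let ?u = "\<lambda>p :: (nat \<Rightarrow> real^2) \<times> (nat \<Rightarrow> real).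
      snd p 0 + (\<Sum>l. norm (fst p l) powr (- \<alpha>) * snd p (Suc l))"
  note [measurable] = measurable_fst_component measurable_snd_component
  have "?u \<in> borel_measurable ((\<Pi>\<^sub>M l\<in>UNIV. borel) \<Otimes>\<^sub>M (\<Pi>\<^sub>M i\<in>UNIV. borel))"
    by measurable
  moreover have "AE \<omega> in P. 0 \<le> Y \<omega> + interference \<alpha> X \<Psi> \<omega>"
    using Y_nonneg interference_nonneg by eventually_elim simp
  ultimately have "prob {\<omega> \<in> space P. W \<omega> / (Y \<omega> + interference \<alpha> X \<Psi> \<omega> + 1) \<le> \<beta>} =
    expectation (\<lambda>\<omega>. W_cdf (\<beta> * (Y \<omega> + interference \<alpha> X \<Psi> \<omega> + 1)))"
    by (intro prob_ratio_le[of ?u]) (simp_all add: interference_def)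
  then show ?thesis by (simp add: outage_prob_def sinr_def interference_def)
qed

text \<open>The factor \<open>t\<close> will be \<open>\<mu> powr (\<alpha> / 2)\<close>, with the
  interference kept at one intensity. Continuity of the distribution function of \<open>W\<close>
  passes through the expectation by dominated convergence.\<close>

lemma scaled_outage_continuous:
  "continuous_on UNIV (\<lambda>t. expectation (\<lambda>\<omega>. W_cdf (\<beta> * (Y \<omega> + t * interference \<alpha> X \<Psi> \<omega> + 1))))"
proof (rule continuous_on_sequentiallyI)
  fix u :: "nat \<Rightarrow> real" and t assume u: "u \<longlonglongrightarrow> t"
  show "(\<lambda>n. expectation (\<lambda>\<omega>. W_cdf (\<beta> * (Y \<omega> + u n * interference \<alpha> X \<Psi> \<omega> + 1))))
    \<longlonglongrightarrow> expectation (\<lambda>\<omega>. W_cdf (\<beta> * (Y \<omega> + t * interference \<alpha> X \<Psi> \<omega> + 1)))"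
  proof (rule integral_dominated_convergence[where w = "\<lambda>_. 1"])
    show "AE \<omega> in P. (\<lambda>n. W_cdf (\<beta> * (Y \<omega> + u n * interference \<alpha> X \<Psi> \<omega> + 1)))
      \<longlonglongrightarrow> W_cdf (\<beta> * (Y \<omega> + t * interference \<alpha> X \<Psi> \<omega> + 1))"
      by (intro AE_I2 isCont_tendsto_compose[OF gamma_cdf_isCont[OF W_gamma]] tendsto_intros u)
  qed (auto simp: W_distr.cdf_nonneg W_distr.cdf_bounded_prob)
qed

lemma scaled_outage_strict_mono:
  assumes "0 < \<beta>" "0 \<le> s" "s < t"
  shows "expectation (\<lambda>\<omega>. W_cdf (\<beta> * (Y \<omega> + s * interference \<alpha> X \<Psi> \<omega> + 1))) <
    expectation (\<lambda>\<omega>. W_cdf (\<beta> * (Y \<omega> + t * interference \<alpha> X \<Psi> \<omega> + 1)))"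
proof (rule integral_less_AE_space)
  show "AE \<omega> in P. W_cdf (\<beta> * (Y \<omega> + s * interference \<alpha> X \<Psi> \<omega> + 1)) <
      W_cdf (\<beta> * (Y \<omega> + t * interference \<alpha> X \<Psi> \<omega> + 1))"
    using Y_nonneg interference_pos
    by eventually_elim (use assms in \<open>intro gamma_cdf_strict_mono[OF W_gamma scale_pos], auto\<close>)
qed (auto intro: W_cdf_integrable simp: emeasure_space_1)

lemma scaled_outage_at_top:
  assumes "0 < \<beta>"
  shows "((\<lambda>t. expectation (\<lambda>\<omega>. W_cdf (\<beta> * (Y \<omega> + t * interference \<alpha> X \<Psi> \<omega> + 1)))) \<longlongrightarrow> 1) at_top"
proof -
  have "((\<lambda>t. expectation (\<lambda>\<omega>. W_cdf (\<beta> * (Y \<omega> + t * interference \<alpha> X \<Psi> \<omega> + 1))))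
    \<longlongrightarrow> expectation (\<lambda>_. 1)) at_top"
  proof (rule integral_dominated_convergence_at_top[where w = "\<lambda>_. 1"])
    show "AE \<omega> in P. ((\<lambda>t. W_cdf (\<beta> * (Y \<omega> + t * interference \<alpha> X \<Psi> \<omega> + 1))) \<longlongrightarrow> 1) at_top"
      using interference_pos
    proof eventually_elim
      case (elim \<omega>)
      have "LIM t at_top. \<beta> * (y + t * i + 1) :> at_top" if "0 < i" for y i
        using that assms by real_asymp
      from this[OF elim] show ?case by (rule filterlim_compose[OF W_distr.cdf_lim_at_top_prob])
    qed
  qed (auto simp: W_distr.cdf_nonneg W_distr.cdf_bounded_prob)
  then show ?thesis by (simp add: prob_space)
qed

end

text \<open>\<open>Y\<close> plus the interference at intensity \<open>\<mu>\<close>, and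
  \<open>Y\<close> plus the rescaled interference at intensity 1, have equal Laplace transforms at
  positive integers, because \<open>\<mu> * k powr (2 / \<alpha>) = (k * \<mu> powr (\<alpha> / 2))
  powr (2 / \<alpha>)\<close>. The outage is the expectation of a continuous function of the
  exponential of minus this sum, so equality of these transforms suffices and no coupling is
  involved.\<close>

lemma outage_prob_scaling:
  assumes S: "stream rcv \<alpha> \<rho> r N M \<mu> P X \<Psi> W Y"
    and S1: "stream rcv \<alpha> \<rho> r N M 1 P X1 \<Psi>1 W Y" and "0 < \<beta>"
  shows "outage_prob P \<alpha> X \<Psi> W Y \<beta> =
    (\<integral>\<omega>. cdf (distr P borel W) (\<beta> * (Y \<omega> + \<mu> powr (\<alpha> / 2) * interference \<alpha> X1 \<Psi>1 \<omega> + 1)) \<partial>P)"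
proof -
  interpret S: stream rcv \<alpha> \<rho> r N M \<mu> P X \<Psi> W Y by fact
  interpret S1: stream rcv \<alpha> \<rho> r N M 1 P X1 \<Psi>1 W Y by fact
  let ?c = "\<mu> powr (\<alpha> / 2)"
  let ?U = "\<lambda>\<omega>. Y \<omega> + interference \<alpha> X \<Psi> \<omega>" and ?V = "\<lambda>\<omega>. Y \<omega> + ?c * interference \<alpha> X1 \<Psi>1 \<omega>"
  define q where "q = (\<lambda>t. if t \<le> 0 then 1 else S.W_cdf (\<beta> * (1 - ln t)))"
  have q_exp: "q (exp (- u)) = S.W_cdf (\<beta> * (u + 1))" for u
    by (simp add: q_def add.commute)
  have c: "0 < ?c" using S.mu by simp
  have "S.expectation (\<lambda>\<omega>. q (exp (- ?U \<omega>))) = S.expectation (\<lambda>\<omega>. q (exp (- ?V \<omega>)))"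
  proof (rule S.expectation_exp_eq_of_moments[where q = q and U = ?U and V = ?V])
    show "AE \<omega> in P. 0 \<le> ?U \<omega>"
      using S.Y_nonneg S.interference_nonneg by eventually_elim simp
    show "AE \<omega> in P. 0 \<le> ?V \<omega>"
      using S.Y_nonneg S1.interference_nonneg by eventually_elim simp
  next
    fix k :: nat assume k: "0 < k"
    have "\<mu> * k powr (2 / \<alpha>) = (k * ?c) powr (2 / \<alpha>)"
      using S.alpha S.mu by (simp add: powr_mult powr_powr)
    then show "S.expectation (\<lambda>\<omega>. exp (- (k * ?U \<omega>))) = S.expectation (\<lambda>\<omega>. exp (- (k * ?V \<omega>)))"
      using S.laplace[of k k] S1.laplace[of k "k * ?c"] k c
      by (simp add: distrib_left mult.assoc[symmetric])
  next
    show "continuous_on {0..1} q"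
      unfolding q_def
      by (rule S.W_distr.cdf_exp_transform_continuous[OF S.gamma_cdf_isCont[OF S.W_gamma] \<open>0 < \<beta>\<close>])
    show "q \<in> borel_measurable borel" unfolding q_def by measurable
  qed measurable
  then show ?thesis
    by (simp only: q_exp S.outage_prob_eq)
qed

text \<open>In terms of the factor \<open>t\<close>, the noise-only outage is
  \<open>\<phi> 0\<close>, so the hypothesis on \<open>\<epsilon>\<close> places it strictly between
  \<open>\<phi> 0\<close> and the limit 1. The intermediate value theorem gives existence and strict
  monotonicity uniqueness; \<open>t powr (2 / \<alpha>)\<close> converts back to an
  intensity.\<close>

lemma ex1_intensity:
  assumes S: "\<And>\<mu>. 0 < \<mu> \<Longrightarrow> stream rcv \<alpha> \<rho> r N M \<mu> P (X \<mu>) (\<Psi> \<mu>) W Y" and "0 < \<beta>"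
    and eps: "measure P {\<omega> \<in> space P. W \<omega> / (Y \<omega> + 1) \<le> \<beta>} < \<epsilon>" "\<epsilon> < 1"
  shows "\<exists>!\<mu>. 0 < \<mu> \<and> \<epsilon> = outage_prob P \<alpha> (X \<mu>) (\<Psi> \<mu>) W Y \<beta>"
proof -
  interpret stream rcv \<alpha> \<rho> r N M 1 P "X 1" "\<Psi> 1" W Y by (rule S) simp
  define \<phi> where "\<phi> t = expectation (\<lambda>\<omega>. W_cdf (\<beta> * (Y \<omega> + t * interference \<alpha> (X 1) (\<Psi> 1) \<omega> + 1)))" for t
  have outage: "outage_prob P \<alpha> (X \<mu>) (\<Psi> \<mu>) W Y \<beta> = \<phi> (\<mu> powr (\<alpha> / 2))" if "0 < \<mu>" for \<mu>
    unfolding \<phi>_def by (rule outage_prob_scaling[OF S[OF that] S[of 1] \<open>0 < \<beta>\<close>]) simp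
  have mono: "\<phi> s < \<phi> t" if "0 \<le> s" "s < t" for s t
    unfolding \<phi>_def by (rule scaled_outage_strict_mono[OF \<open>0 < \<beta>\<close> that])
  have phi0: "\<phi> 0 < \<epsilon>" using eps(1) by (simp add: \<phi>_def prob_noise_le)
  have "\<forall>\<^sub>F t in at_top. \<epsilon> < \<phi> t"
    unfolding \<phi>_def by (rule order_tendstoD(1)[OF scaled_outage_at_top[OF \<open>0 < \<beta>\<close>] eps(2)])
  with eventually_ge_at_top[of 0] have "\<forall>\<^sub>F t in at_top. 0 \<le> t \<and> \<epsilon> < \<phi> t" by eventually_elim simp
  then obtain T where T: "0 \<le> T" "\<epsilon> < \<phi> T" by (auto simp: eventually_at_top_linorder)
  have "continuous_on {0..T} \<phi>"
    unfolding \<phi>_def by (rule continuous_on_subset[OF scaled_outage_continuous]) simp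
  then obtain t where t: "0 \<le> t" "\<phi> t = \<epsilon>"
    using IVT'[of \<phi> 0 \<epsilon> T] T phi0 by auto
  then have "0 < t" using phi0 by (cases "t = 0") auto
  show ?thesis
  proof (rule ex1I[of _ "t powr (2 / \<alpha>)"])
    show "0 < t powr (2 / \<alpha>) \<and> \<epsilon> = outage_prob P \<alpha> (X (t powr (2 / \<alpha>))) (\<Psi> (t powr (2 / \<alpha>))) W Y \<beta>"
      using \<open>0 < t\<close> t alpha by (simp add: outage powr_powr)
    fix \<mu> assume \<mu>: "0 < \<mu> \<and> \<epsilon> = outage_prob P \<alpha> (X \<mu>) (\<Psi> \<mu>) W Y \<beta>"
    then have "\<phi> (\<mu> powr (\<alpha> / 2)) = \<phi> t" using outage t by simp
    then have "\<mu> powr (\<alpha> / 2) = t"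
      using mono[of "\<mu> powr (\<alpha> / 2)" t] mono[of t "\<mu> powr (\<alpha> / 2)"] t(1) by fastforce
    then show "\<mu> = t powr (2 / \<alpha>)" using \<mu> alpha by (auto simp: powr_powr)
  qed
qed

section \<open>Bounds on the intensity\<close>

lemma (in prob_space) gamma_moments:
  assumes Z: "gamma_distributed M Z v \<theta>" and "1 \<le> v" "0 < \<theta>"
  shows "integrable M Z" "integrable M (\<lambda>\<omega>. (Z \<omega>)\<^sup>2)" "expectation Z = v * \<theta>" "variance Z = v * \<theta>\<^sup>2"
proof -
  have D: "distributed M lborel Z (\<lambda>x. ennreal (erlang_density (v - 1) (1 / \<theta>) x))"
    using Z by (simp add: gamma_distributed_def)
  have l: "0 < 1 / \<theta>" using \<open>0 < \<theta>\<close> by simp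
  obtain k where v: "v = Suc k" using \<open>1 \<le> v\<close> by (cases v) auto
  show "integrable M Z" using erlang_ith_moment_integrable[OF l D, of 1] by simp
  show "integrable M (\<lambda>\<omega>. (Z \<omega>)\<^sup>2)" by (rule erlang_ith_moment_integrable[OF l D])
  show "expectation Z = v * \<theta>" using erlang_ith_moment[OF l D, of 1] by (simp add: v)
  show "variance Z = v * \<theta>\<^sup>2"
    using erlang_distributed_variance[OF l D] by (simp add: v power_divide)
qed

lemma (in prob_space) gamma_deviation:
  assumes Z: "gamma_distributed M Z v \<theta>" and "1 \<le> v" "0 < \<theta>" "0 < \<delta>"
  shows "prob {\<omega> \<in> space M. \<delta> \<le> \<bar>Z \<omega> - v * \<theta>\<bar>} \<le> v * \<theta>\<^sup>2 / \<delta>\<^sup>2"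
  using Chebyshev_inequality[of Z \<delta>] gamma_moments[OF assms(1-3)] \<open>0 < \<delta>\<close>
  by (simp add: borel_measurable_integrable)

section \<open>Tails of the interference and their effect on the outage probability\<close>

context stream
begin

lemma exp_interference_integrable:
  "0 < s \<Longrightarrow> integrable P (\<lambda>\<omega>. exp (- (s * interference \<alpha> X \<Psi> \<omega>)))"
  by (rule integrable_const_bound[of _ 1], use interference_nonneg in eventually_elim) auto

text \<open>Chernoff bound at \<open>s = 1 / a\<close>: on the event,
  \<open>exp (1 - interference / a)\<close> is at least 1.\<close>

lemma prob_interference_less:
  assumes "0 < a"
  shows "prob {\<omega> \<in> space P. interference \<alpha> X \<Psi> \<omega> < a} \<le>
    exp (1 - \<mu> * ((1 / a) powr (2 / \<alpha>) * shot_exponent \<alpha> \<rho> M))"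
proof -
  let ?I = "interference \<alpha> X \<Psi>"
  have "prob {\<omega> \<in> space P. ?I \<omega> < a} = expectation (indicator {\<omega> \<in> space P. ?I \<omega> < a})" by simp
  also have "\<dots> \<le> expectation (\<lambda>\<omega>. exp 1 * exp (- ((1 / a) * ?I \<omega>)))"
  proof (rule integral_mono_AE)
    show "integrable P (\<lambda>\<omega>. exp 1 * exp (- ((1 / a) * ?I \<omega>)))"
      using assms by (intro integrable_mult_right exp_interference_integrable) simp
    show "AE \<omega> in P. indicator {\<omega> \<in> space P. ?I \<omega> < a} \<omega> \<le> exp 1 * exp (- ((1 / a) * ?I \<omega>))"
      using assms by (intro AE_I2) (auto simp: exp_add[symmetric] split: split_indicator)
  qed (simp add: less_top[symmetric])
  also have "\<dots> = exp 1 * exp (- (\<mu> * ((1 / a) powr (2 / \<alpha>) * shot_exponent \<alpha> \<rho> M)))"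
    using laplace_interference[of "1 / a"] assms by simp
  finally show ?thesis by (simp add: exp_add[symmetric])
qed

text \<open>Markov's inequality for the bounded variable
  \<open>1 - exp (- interference / \<eta>)\<close>, which exceeds \<open>1 - exp (- 1)\<close> on
  the event; its mean is then bounded by \<open>1 - exp (- x) \<le> x\<close>. The interference
  itself has infinite mean.\<close>

lemma prob_interference_greater:
  assumes "0 < \<eta>"
  shows "prob {\<omega> \<in> space P. \<eta> < interference \<alpha> X \<Psi> \<omega>} \<le>
    \<mu> * ((1 / \<eta>) powr (2 / \<alpha>) * shot_exponent \<alpha> \<rho> M) / (1 - exp (- 1))"
proof -
  let ?I = "interference \<alpha> X \<Psi>" and ?d = "1 - exp (- 1 :: real)"
  let ?x = "\<mu> * ((1 / \<eta>) powr (2 / \<alpha>) * shot_exponent \<alpha> \<rho> M)"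
  have d: "0 < ?d" by simp
  have int: "integrable P (\<lambda>\<omega>. exp (- ((1 / \<eta>) * ?I \<omega>)))"
    using assms by (intro exp_interference_integrable) simp
  have "prob {\<omega> \<in> space P. \<eta> < ?I \<omega>} = expectation (indicator {\<omega> \<in> space P. \<eta> < ?I \<omega>})" by simp
  also have "\<dots> \<le> expectation (\<lambda>\<omega>. (1 - exp (- ((1 / \<eta>) * ?I \<omega>))) / ?d)"
  proof (rule integral_mono_AE)
    show "integrable P (\<lambda>\<omega>. (1 - exp (- ((1 / \<eta>) * ?I \<omega>))) / ?d)"
      using int by (intro integrable_divide Bochner_Integration.integrable_diff) auto
    show "AE \<omega> in P. indicator {\<omega> \<in> space P. \<eta> < ?I \<omega>} \<omega> \<le> (1 - exp (- ((1 / \<eta>) * ?I \<omega>))) / ?d"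
      using interference_nonneg
    proof eventually_elim
      case (elim \<omega>)
      have "?d \<le> 1 - exp (- ((1 / \<eta>) * ?I \<omega>))" if "\<eta> < ?I \<omega>"
        using that assms by simp
      moreover have "0 \<le> 1 - exp (- ((1 / \<eta>) * ?I \<omega>))" using elim assms by simp
      ultimately show ?case using d
        by (auto simp: le_divide_eq split: split_indicator)
    qed
  qed (simp add: less_top[symmetric])
  also have "\<dots> = (1 - exp (- ?x)) / ?d"
    using laplace_interference[of "1 / \<eta>"] assms int
    by (simp add: Bochner_Integration.integral_diff prob_space)
  also have "\<dots> \<le> ?x / ?d"
    using d exp_ge_add_one_self[of "- ?x"] by (intro divide_right_mono) auto
  finally show ?thesis .
qed

lemma outage_prob_AE:
  "outage_prob P \<alpha> X \<Psi> W Y \<beta> =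
    prob {\<omega> \<in> space P. W \<omega> \<le> \<beta> * (Y \<omega> + interference \<alpha> X \<Psi> \<omega> + 1)}"
  unfolding outage_prob_def
proof (rule finite_measure_eq_AE)
  show "AE \<omega> in P. \<omega> \<in> {\<omega> \<in> space P. sinr \<alpha> X \<Psi> W Y \<omega> \<le> \<beta>} \<longleftrightarrow>
      \<omega> \<in> {\<omega> \<in> space P. W \<omega> \<le> \<beta> * (Y \<omega> + interference \<alpha> X \<Psi> \<omega> + 1)}"
    using Y_nonneg interference_nonneg AE_space
    by eventually_elim (auto simp: sinr_def interference_def[symmetric] divide_le_eq)
qed (simp_all add: sinr_def interference_def[symmetric])

text \<open>
  An interference of order \<open>N / M\<close> forces an outage by Markov's inequality for \<open>W\<close>, and the
  interference grows like \<open>\<mu> powr (\<alpha> / 2)\<close>.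
\<close>
lemma intensity_le:
  assumes "0 < \<beta>" "\<epsilon> < 1" and out: "outage_prob P \<alpha> X \<Psi> W Y \<beta> \<le> \<epsilon>"
  shows "\<mu> \<le> (1 - ln ((1 - \<epsilon>) / 2)) * (2 * \<rho> / (r powr \<alpha> * \<beta> * (1 - \<epsilon>))) powr (2 / \<alpha>) /
      (\<rho> / (1 + \<rho>) * measure lborel (ball (0 :: real^2) 1)) * (real N / M) powr (2 / \<alpha>)"
proof -
  let ?I = "interference \<alpha> X \<Psi>" and ?K = "shot_exponent \<alpha> \<rho> M"
  define k0 where "k0 = \<rho> / (1 + \<rho>) * measure lborel (ball (0 :: real^2) 1)"
  define v where "v = (case rcv of MRC \<Rightarrow> N | ZF \<Rightarrow> N - M + 1)"
  define \<theta> where "\<theta> = \<rho> / (M * r powr \<alpha>)"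
  \<comment> \<open>Chosen so that Markov's inequality for \<open>W\<close> at level
    \<open>\<beta> * a\<close> yields exactly \<open>(1 - \<epsilon>) / 2\<close>, half of the
    guaranteed success probability; the other half must come from interference below
    \<open>a\<close>.\<close>
  define b where "b = 2 * \<rho> / (r powr \<alpha> * \<beta> * (1 - \<epsilon>))"
  define a where "a = b * (real N / M)"
  have v: "1 \<le> v" "v \<le> N" using M by (auto simp: v_def split: receiver.split)
  have \<theta>: "0 < \<theta>" using scale_pos by (simp add: \<theta>_def)
  have b: "0 < b" using assms rho r by (simp add: b_def)
  then have a: "0 < a" using M by (simp add: a_def)
  have "0 < measure lborel (ball (0 :: real^2) 1)"
    using content_ball_pos[of 1 "0 :: real^2"] by simp
  then have k0: "0 < k0" "k0 \<le> ?K"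
    using rho shot_exponent_lower[OF alpha rho M(1)] by (auto simp: k0_def)
  have Wg: "gamma_distributed P W v \<theta>" using W_gamma by (simp add: v_def \<theta>_def)
  have "prob {\<omega> \<in> space P. \<beta> * a \<le> W \<omega>} \<le> expectation W / (\<beta> * a)"
    using gamma_moments(1)[OF Wg v(1) \<theta>] gamma_AE_nonneg[OF Wg] a assms
    by (intro integral_Markov_inequality_measure[where A = "{}"]) auto
  also have "\<dots> \<le> N * \<theta> / (\<beta> * a)"
    unfolding gamma_moments(3)[OF Wg v(1) \<theta>] using v \<theta> a assms
    by (intro divide_right_mono mult_right_mono) auto
  also have "\<dots> = (1 - \<epsilon>) / 2"
    using assms rho r M by (simp add: \<theta>_def a_def b_def field_simps)
  finally have markov: "prob {\<omega> \<in> space P. \<beta> * a \<le> W \<omega>} \<le> (1 - \<epsilon>) / 2" .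
  have "1 - \<epsilon> \<le> 1 - prob {\<omega> \<in> space P. W \<omega> \<le> \<beta> * (Y \<omega> + ?I \<omega> + 1)}"
    using out by (simp add: outage_prob_AE)
  also have "\<dots> = prob {\<omega> \<in> space P. \<not> W \<omega> \<le> \<beta> * (Y \<omega> + ?I \<omega> + 1)}"
    by (subst prob_neg) auto
  also have "\<dots> \<le> prob ({\<omega> \<in> space P. ?I \<omega> < a} \<union> {\<omega> \<in> space P. \<beta> * a \<le> W \<omega>})"
  proof (rule finite_measure_mono_AE)
    show "AE \<omega> in P. \<omega> \<in> {\<omega> \<in> space P. \<not> W \<omega> \<le> \<beta> * (Y \<omega> + ?I \<omega> + 1)} \<longrightarrow>
        \<omega> \<in> {\<omega> \<in> space P. ?I \<omega> < a} \<union> {\<omega> \<in> space P. \<beta> * a \<le> W \<omega>}"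
      using Y_nonneg
    proof eventually_elim
      case (elim \<omega>)
      have "\<beta> * a \<le> W \<omega>" if "\<not> W \<omega> \<le> \<beta> * (Y \<omega> + ?I \<omega> + 1)" "\<not> ?I \<omega> < a"
      proof -
        have "\<beta> * a \<le> \<beta> * (Y \<omega> + ?I \<omega> + 1)" using that elim assms by (intro mult_left_mono) auto
        then show ?thesis using that by linarith
      qed
      then show ?case by auto
    qed
  qed measurable
  also have "\<dots> \<le> prob {\<omega> \<in> space P. ?I \<omega> < a} + prob {\<omega> \<in> space P. \<beta> * a \<le> W \<omega>}"
    by (rule measure_Un_le) measurable
  also have "\<dots> \<le> exp (1 - \<mu> * ((1 / a) powr (2 / \<alpha>) * ?K)) + (1 - \<epsilon>) / 2"
    by (rule add_mono[OF prob_interference_less[OF a] markov])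
  finally have "(1 - \<epsilon>) / 2 \<le> exp (1 - \<mu> * ((1 / a) powr (2 / \<alpha>) * ?K))" by (simp add: field_simps)
  then have "ln ((1 - \<epsilon>) / 2) \<le> ln (exp (1 - \<mu> * ((1 / a) powr (2 / \<alpha>) * ?K)))"
    using assms by (subst ln_le_cancel_iff) auto
  then have "\<mu> * ((1 / a) powr (2 / \<alpha>) * ?K) \<le> 1 - ln ((1 - \<epsilon>) / 2)" by simp
  \<comment> \<open>Passing from \<open>?K\<close> to its lower bound \<open>k0\<close> removes the
    dependence on \<open>M\<close> from the constant.\<close>
  moreover have "\<mu> * ((1 / a) powr (2 / \<alpha>) * k0) \<le> \<mu> * ((1 / a) powr (2 / \<alpha>) * ?K)"
    using mu k0 by (intro mult_left_mono) auto
  ultimately have "\<mu> * ((1 / a) powr (2 / \<alpha>) * k0) \<le> 1 - ln ((1 - \<epsilon>) / 2)" by linarith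
  then have "\<mu> \<le> (1 - ln ((1 - \<epsilon>) / 2)) * a powr (2 / \<alpha>) / k0"
    using a k0 by (simp add: powr_divide field_simps)
  also have "a powr (2 / \<alpha>) = b powr (2 / \<alpha>) * (real N / M) powr (2 / \<alpha>)"
    using b by (simp add: a_def powr_mult powr_divide)
  finally show ?thesis by (simp add: k0_def b_def mult_ac)
qed

text \<open>An outage with interference at most \<open>\<eta>\<close> is already a failure of the
  signal against \<open>Y + 1 + \<eta>\<close>. The remaining term is linear in
  \<open>\<mu>\<close>, so a prescribed outage probability forces a lower bound on the intensity
  once the signal term is small.\<close>

lemma outage_prob_le:
  assumes "0 < \<beta>" "0 < \<eta>"
  shows "outage_prob P \<alpha> X \<Psi> W Y \<beta> \<le> prob {\<omega> \<in> space P. W \<omega> \<le> \<beta> * (Y \<omega> + 1 + \<eta>)} +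
    \<mu> * ((1 / \<eta>) powr (2 / \<alpha>) * shot_exponent \<alpha> \<rho> M) / (1 - exp (- 1))"
proof -
  let ?I = "interference \<alpha> X \<Psi>"
  have "outage_prob P \<alpha> X \<Psi> W Y \<beta> \<le>
      prob ({\<omega> \<in> space P. W \<omega> \<le> \<beta> * (Y \<omega> + 1 + \<eta>)} \<union> {\<omega> \<in> space P. \<eta> < ?I \<omega>})"
    unfolding outage_prob_AE
  proof (rule finite_measure_mono)
    show "{\<omega> \<in> space P. W \<omega> \<le> \<beta> * (Y \<omega> + ?I \<omega> + 1)} \<subseteq>
        {\<omega> \<in> space P. W \<omega> \<le> \<beta> * (Y \<omega> + 1 + \<eta>)} \<union> {\<omega> \<in> space P. \<eta> < ?I \<omega>}"
    proof (intro subsetI)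
      fix \<omega> assume \<omega>: "\<omega> \<in> {\<omega> \<in> space P. W \<omega> \<le> \<beta> * (Y \<omega> + ?I \<omega> + 1)}"
      have "\<beta> * (Y \<omega> + ?I \<omega> + 1) \<le> \<beta> * (Y \<omega> + 1 + \<eta>)" if "?I \<omega> \<le> \<eta>"
        using that assms by (intro mult_left_mono) auto
      then show "\<omega> \<in> {\<omega> \<in> space P. W \<omega> \<le> \<beta> * (Y \<omega> + 1 + \<eta>)} \<union> {\<omega> \<in> space P. \<eta> < ?I \<omega>}"
        using \<omega> by (auto simp: not_less intro: order_trans)
    qed
  qed measurable
  also have "\<dots> \<le> prob {\<omega> \<in> space P. W \<omega> \<le> \<beta> * (Y \<omega> + 1 + \<eta>)} + prob {\<omega> \<in> space P. \<eta> < ?I \<omega>}"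
    by (rule measure_Un_le) measurable
  finally show ?thesis using prob_interference_greater[OF \<open>0 < \<eta>\<close>] by linarith
qed

text \<open>Lets a single estimate of the right-hand side also supply the condition under which the
  capacity is not set to 0.\<close>

lemma prob_noise_le_shift:
  assumes "0 < \<beta>" "0 < \<eta>"
  shows "prob {\<omega> \<in> space P. W \<omega> / (Y \<omega> + 1) \<le> \<beta>} \<le> prob {\<omega> \<in> space P. W \<omega> \<le> \<beta> * (Y \<omega> + 1 + \<eta>)}"
proof (rule finite_measure_mono_AE)
  show "AE \<omega> in P. \<omega> \<in> {\<omega> \<in> space P. W \<omega> / (Y \<omega> + 1) \<le> \<beta>} \<longrightarrow>
      \<omega> \<in> {\<omega> \<in> space P. W \<omega> \<le> \<beta> * (Y \<omega> + 1 + \<eta>)}"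
    using Y_nonneg
  proof eventually_elim
    case (elim \<omega>)
    then have "\<beta> * (Y \<omega> + 1) \<le> \<beta> * (Y \<omega> + 1 + \<eta>)" using assms by (intro mult_left_mono) auto
    then show ?case using elim by (auto simp: divide_le_eq)
  qed
qed measurable

text \<open>By \<open>sep\<close>, the event forces \<open>W\<close> to miss its mean by at least
  \<open>\<delta>\<close> or \<open>Y\<close> to reach its upper reference value plus
  \<open>\<delta>\<close>. For MRC that value is \<open>M\<close> times the scale, slightly above
  the mean of \<open>Y\<close>. Chebyshev's inequality bounds either deviation by the same term,
  which is of order \<open>1 / N\<close> when \<open>M\<close> is proportional to
  \<open>N\<close>.\<close>

lemma prob_small_signal:
  assumes "0 < \<beta>" "0 < \<delta>"
    and sep: "\<beta> * ((case rcv of MRC \<Rightarrow> \<rho> / r powr \<alpha> | ZF \<Rightarrow> 0) + \<delta> + 1 + \<eta>) \<le>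
      real (case rcv of MRC \<Rightarrow> N | ZF \<Rightarrow> N - M + 1) * (\<rho> / (M * r powr \<alpha>)) - \<delta>"
  shows "prob {\<omega> \<in> space P. W \<omega> \<le> \<beta> * (Y \<omega> + 1 + \<eta>)} \<le> 2 * (N * (\<rho> / (M * r powr \<alpha>))\<^sup>2 / \<delta>\<^sup>2)"
proof -
  define v where "v = (case rcv of MRC \<Rightarrow> N | ZF \<Rightarrow> N - M + 1)"
  define \<theta> where "\<theta> = \<rho> / (M * r powr \<alpha>)"
  define y where "y = (case rcv of MRC \<Rightarrow> \<rho> / r powr \<alpha> | ZF \<Rightarrow> 0)"
  let ?w = "{\<omega> \<in> space P. \<delta> \<le> \<bar>W \<omega> - v * \<theta>\<bar>}" and ?y = "{\<omega> \<in> space P. y + \<delta> \<le> Y \<omega>}"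
  have v: "1 \<le> v" "v \<le> N" using M by (auto simp: v_def split: receiver.split)
  have \<theta>: "0 < \<theta>" using scale_pos by (simp add: \<theta>_def)
  have y: "0 \<le> y" using rho by (auto simp: y_def split: receiver.split)
  have Wg: "gamma_distributed P W v \<theta>" using W_gamma by (simp add: v_def \<theta>_def)
  have "prob ?w \<le> v * \<theta>\<^sup>2 / \<delta>\<^sup>2" by (rule gamma_deviation[OF Wg v(1) \<theta> \<open>0 < \<delta>\<close>])
  also have "\<dots> \<le> N * \<theta>\<^sup>2 / \<delta>\<^sup>2" using v by (intro divide_right_mono mult_right_mono) auto
  finally have w: "prob ?w \<le> N * \<theta>\<^sup>2 / \<delta>\<^sup>2" .
  have yb: "prob ?y \<le> N * \<theta>\<^sup>2 / \<delta>\<^sup>2"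
  proof (cases "rcv = ZF \<or> M = 1")
    case True
    then have "AE \<omega> in P. Y \<omega> = 0"
      using model by (cases rcv) (auto simp: stream_model_def)
    then have "AE \<omega> in P. \<not> y + \<delta> \<le> Y \<omega>" by eventually_elim (use y \<open>0 < \<delta>\<close> in auto)
    then have "prob ?y = 0" by (subst prob_Collect_eq_0) auto
    then show ?thesis by simp
  next
    case False
    then have rcv: "rcv = MRC" and "M \<noteq> 1" using receiver.exhaust by blast+
    then have M2: "1 \<le> M - 1" using M by simp
    have Yg: "gamma_distributed P Y (M - 1) \<theta>"
      using model rcv \<open>M \<noteq> 1\<close> by (simp add: stream_model_def \<theta>_def)
    have "real (M - 1) * \<theta> \<le> M * \<theta>" using \<theta> by (intro mult_right_mono) auto
    also have "\<dots> = y" using M rcv by (simp add: y_def \<theta>_def)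
    finally have "?y \<subseteq> {\<omega> \<in> space P. \<delta> \<le> \<bar>Y \<omega> - real (M - 1) * \<theta>\<bar>}" by auto
    then have "prob ?y \<le> prob {\<omega> \<in> space P. \<delta> \<le> \<bar>Y \<omega> - real (M - 1) * \<theta>\<bar>}"
      by (rule finite_measure_mono) measurable
    also have "\<dots> \<le> real (M - 1) * \<theta>\<^sup>2 / \<delta>\<^sup>2" by (rule gamma_deviation[OF Yg M2 \<theta> \<open>0 < \<delta>\<close>])
    also have "\<dots> \<le> N * \<theta>\<^sup>2 / \<delta>\<^sup>2" using M by (intro divide_right_mono mult_right_mono) auto
    finally show ?thesis .
  qed
  have "prob {\<omega> \<in> space P. W \<omega> \<le> \<beta> * (Y \<omega> + 1 + \<eta>)} \<le> prob (?w \<union> ?y)"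
  proof (rule finite_measure_mono)
    show "{\<omega> \<in> space P. W \<omega> \<le> \<beta> * (Y \<omega> + 1 + \<eta>)} \<subseteq> ?w \<union> ?y"
    proof (intro subsetI)
      fix \<omega> assume "\<omega> \<in> {\<omega> \<in> space P. W \<omega> \<le> \<beta> * (Y \<omega> + 1 + \<eta>)}"
      then have \<omega>: "\<omega> \<in> space P" and W: "W \<omega> \<le> \<beta> * (Y \<omega> + 1 + \<eta>)" by auto
      have "\<delta> \<le> \<bar>W \<omega> - v * \<theta>\<bar>" if "\<not> y + \<delta> \<le> Y \<omega>"
      proof -
        have "\<beta> * (Y \<omega> + 1 + \<eta>) \<le> \<beta> * (y + \<delta> + 1 + \<eta>)"
          using that assms by (intro mult_left_mono) auto
        also have "\<dots> \<le> v * \<theta> - \<delta>" using sep by (simp add: v_def \<theta>_def y_def)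
        finally show ?thesis using W by linarith
      qed
      then show "\<omega> \<in> ?w \<union> ?y" using \<omega> by auto
    qed
  qed measurable
  also have "\<dots> \<le> prob ?w + prob ?y" by (rule measure_Un_le) measurable
  also have "\<dots> \<le> N * \<theta>\<^sup>2 / \<delta>\<^sup>2 + N * \<theta>\<^sup>2 / \<delta>\<^sup>2" by (rule add_mono[OF w yb])
  also have "\<dots> = 2 * (N * \<theta>\<^sup>2 / \<delta>\<^sup>2)" by simp
  finally show ?thesis by (simp only: \<theta>_def)
qed

end

section \<open>Assembly of the linear, upper and sub-linear scaling statements\<close>

theorem proposition1:
  fixes rcv :: receiver
    and \<alpha> \<rho> r \<beta> \<epsilon> :: real
    and M :: "nat \<Rightarrow> nat"
    and P :: "nat \<Rightarrow> 'a measure"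
    and X :: "nat \<Rightarrow> real \<Rightarrow> nat \<Rightarrow> 'a \<Rightarrow> real^2"
    and \<Psi> :: "nat \<Rightarrow> real \<Rightarrow> nat \<Rightarrow> 'a \<Rightarrow> real"
    and W Y :: "nat \<Rightarrow> 'a \<Rightarrow> real"
    and c :: "nat \<Rightarrow> real"
  defines "c \<equiv> \<lambda>N. transmission_capacity (P N) \<alpha> \<beta> (M N) (X N) (\<Psi> N) (W N) (Y N) \<epsilon>"
  assumes "\<alpha> > 2" and "\<rho> > 0" and "r > 0" and "\<beta> > 0" and "0 < \<epsilon>" and "\<epsilon> < 1"
    and streams: "\<And>N. N \<ge> 1 \<Longrightarrow> 1 \<le> M N \<and> M N \<le> N"
    and model: "\<And>N \<mu>. N \<ge> 1 \<Longrightarrow> \<mu> > 0 \<Longrightarrow>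
      stream_model rcv \<alpha> \<rho> r N (M N) \<mu> (P N) (X N \<mu>) (\<Psi> N \<mu>) (W N) (Y N)"
  shows "(\<forall>\<kappa>. 0 < \<kappa> \<and> \<kappa> < 1 \<and> \<beta> < beta_bar rcv \<alpha> \<rho> r \<kappa> \<and>
             (\<forall>N \<ge> 1. \<kappa> * real N \<in> \<int> \<longrightarrow> real (M N) = \<kappa> * real N) \<longrightarrow>
             Theta_within {N. \<kappa> * real N \<in> \<int>} c (\<lambda>N. real N)) \<and>
         c \<in> O(\<lambda>N. real N) \<and>
         ((\<lambda>N. real (M N)) \<in> o(\<lambda>N. real N) \<longrightarrow> c \<in> o(\<lambda>N. real N))"
proof -
  note pos = \<open>\<alpha> > 2\<close> \<open>\<rho> > 0\<close> \<open>r > 0\<close> \<open>\<beta> > 0\<close> \<open>0 < \<epsilon>\<close> \<open>\<epsilon> < 1\<close>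
  have stream: "stream rcv \<alpha> \<rho> r N (M N) \<mu> (P N) (X N \<mu>) (\<Psi> N \<mu>) (W N) (Y N)"
    if "1 \<le> N" "0 < \<mu>" for N \<mu>
    using that pos streams[OF that(1)] model by unfold_locales auto
  let ?P0 = "\<lambda>N. measure (P N) {\<omega> \<in> space (P N). W N \<omega> / (Y N \<omega> + 1) \<le> \<beta>}"
  have intensity: "\<exists>\<mu>::real. 0 < \<mu> \<and> outage_prob (P N) \<alpha> (X N \<mu>) (\<Psi> N \<mu>) (W N) (Y N) \<beta> = \<epsilon> \<and>
      c N = real (M N) * \<mu> * (1 - \<epsilon>)" if N: "1 \<le> N" and P0: "?P0 N < \<epsilon>" for N
  proof -
    let ?\<mu> = "THE \<mu>. 0 < \<mu> \<and> \<epsilon> = outage_prob (P N) \<alpha> (X N \<mu>) (\<Psi> N \<mu>) (W N) (Y N) \<beta>"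
    have "0 < ?\<mu> \<and> \<epsilon> = outage_prob (P N) \<alpha> (X N ?\<mu>) (\<Psi> N ?\<mu>) (W N) (Y N) \<beta>"
      by (rule theI', rule ex1_intensity[OF stream[OF N]]) (use P0 pos in auto)
    moreover have "c N = M N * ?\<mu> * (1 - \<epsilon>)"
      using P0 by (simp add: c_def transmission_capacity_def)
    ultimately show ?thesis by (intro exI[of _ ?\<mu>]) auto
  qed
  have c0: "c N = 0" if "\<not> ?P0 N < \<epsilon>" for N
    using that by (simp add: c_def transmission_capacity_def)
  define D where "D = (1 - ln ((1 - \<epsilon>) / 2)) * (2 * \<rho> / (r powr \<alpha> * \<beta> * (1 - \<epsilon>))) powr (2 / \<alpha>) /
      (\<rho> / (1 + \<rho>) * measure lborel (ball (0 :: real^2) 1))"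
  have "ln ((1 - \<epsilon>) / 2) \<le> 0" using pos by (subst ln_le_zero_iff) auto
  then have "ln ((1 - \<epsilon>) / 2) \<le> 1" by linarith
  then have D: "0 \<le> D"
    unfolding D_def using pos by (intro divide_nonneg_nonneg mult_nonneg_nonneg) auto
  have "\<exists>C. \<forall>N\<ge>1. 0 \<le> c N \<and> c N \<le> C * (real N * (real (M N) / N) powr (1 - 2 / \<alpha>))"
  proof (intro exI allI impI)
    fix N :: nat assume N: "1 \<le> N"
    have M_pos: "0 < real (M N)" "real (M N) \<le> N" using streams[OF N] by auto
    have *: "real (M N) * (real N / M N) powr (2 / \<alpha>) = real N * (real (M N) / N) powr (1 - 2 / \<alpha>)"
      using M_pos N by (simp add: powr_diff powr_divide)
    show "0 \<le> c N \<and> c N \<le> (D * (1 - \<epsilon>)) * (real N * (real (M N) / N) powr (1 - 2 / \<alpha>))"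
    proof (cases "?P0 N < \<epsilon>")
      case True
      then obtain \<mu> :: real where \<mu>: "0 < \<mu>" "outage_prob (P N) \<alpha> (X N \<mu>) (\<Psi> N \<mu>) (W N) (Y N) \<beta> = \<epsilon>"
          "c N = real (M N) * \<mu> * (1 - \<epsilon>)" using intensity[OF N] by blast
      interpret stream rcv \<alpha> \<rho> r N "M N" \<mu> "P N" "X N \<mu>" "\<Psi> N \<mu>" "W N" "Y N"
        by (rule stream[OF N \<mu>(1)])
      have "\<mu> \<le> D * (real N / M N) powr (2 / \<alpha>)"
        unfolding D_def by (rule intensity_le) (use \<mu> pos in auto)
      then have "M N * \<mu> * (1 - \<epsilon>) \<le> M N * (D * (real N / M N) powr (2 / \<alpha>)) * (1 - \<epsilon>)"
        using pos M_pos by (intro mult_right_mono mult_left_mono) auto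
      also have "\<dots> = D * (1 - \<epsilon>) * (real (M N) * (real N / M N) powr (2 / \<alpha>))" by (simp only: mult_ac)
      finally show ?thesis using \<mu> pos M_pos unfolding * by auto
    next
      case False
      then show ?thesis using c0[OF False] D pos by simp
    qed
  qed
  then obtain C where C: "\<And>N. 1 \<le> N \<Longrightarrow> 0 \<le> c N"
      "\<And>N. 1 \<le> N \<Longrightarrow> c N \<le> C * (real N * (real (M N) / N) powr (1 - 2 / \<alpha>))"
    by blast
  \<comment> \<open>The power is at most 1, since \<open>M N \<le> N\<close> and the exponent
    \<open>1 - 2 / \<alpha>\<close> is positive. The absolute value is taken because the sign of
    \<open>C\<close> is not recorded.\<close>
  have C': "c N \<le> \<bar>C\<bar> * N" if N: "1 \<le> N" for N
  proof -
    have "c N \<le> C * (real N * (real (M N) / N) powr (1 - 2 / \<alpha>))" using C(2)[OF N] .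
    also have "\<dots> \<le> \<bar>C\<bar> * (real N * 1)"
      using streams[OF N] pos by (intro mult_mono powr_le1) auto
    finally show ?thesis by simp
  qed
  have bigo: "c \<in> O(\<lambda>N. real N)"
  proof (rule bigoI[where c = "\<bar>C\<bar>"])
    show "\<forall>\<^sub>F N in sequentially. norm (c N) \<le> \<bar>C\<bar> * norm (real N)"
      using eventually_ge_at_top[of 1] by eventually_elim (use C(1) C' in auto)
  qed
  have smallo: "c \<in> o(\<lambda>N. real N)" if "(\<lambda>N. real (M N)) \<in> o(\<lambda>N. real N)"
  proof (rule smalloI_tendsto)
    have lim: "(\<lambda>N. real (M N) / N) \<longlonglongrightarrow> 0" using that by (rule smalloD_tendsto)
    have "(\<lambda>N. C * (real (M N) / N) powr (1 - 2 / \<alpha>)) \<longlonglongrightarrow> C * 0 powr (1 - 2 / \<alpha>)"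
      using pos by (intro tendsto_mult tendsto_const tendsto_powr'[OF lim]) auto
    then have lim': "(\<lambda>N. C * (real (M N) / N) powr (1 - 2 / \<alpha>)) \<longlonglongrightarrow> 0" by simp
    show "(\<lambda>N. c N / real N) \<longlonglongrightarrow> 0"
    proof (rule tendsto_sandwich[OF _ _ tendsto_const lim'])
      show "\<forall>\<^sub>F N in sequentially. 0 \<le> c N / real N"
        using eventually_ge_at_top[of 1] by eventually_elim (use C(1) in auto)
      show "\<forall>\<^sub>F N in sequentially. c N / real N \<le> C * (real (M N) / N) powr (1 - 2 / \<alpha>)"
        using eventually_ge_at_top[of 1]
      proof eventually_elim
        case (elim N)
        then show ?case using C(2)[OF elim] by (simp add: divide_le_eq mult_ac)
      qed
    qed
    show "\<forall>\<^sub>F N in sequentially. real N \<noteq> 0"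
      using eventually_ge_at_top[of 1] by eventually_elim auto
  qed
  have theta: "Theta_within {N. \<kappa> * real N \<in> \<int>} c (\<lambda>N. real N)"
    if \<kappa>: "0 < \<kappa>" "\<kappa> < 1" and \<beta>: "\<beta> < beta_bar rcv \<alpha> \<rho> r \<kappa>"
      and MN: "\<forall>N \<ge> 1. \<kappa> * real N \<in> \<int> \<longrightarrow> real (M N) = \<kappa> * real N" for \<kappa>
  proof -
    define R where "R = \<rho> / r powr \<alpha>"
    have R: "0 < R" using pos by (simp add: R_def)
    \<comment> \<open>For \<open>M = \<kappa> N\<close>, \<open>y\<close> and \<open>w\<close> are
      the limits of the means of \<open>Y\<close> and \<open>W\<close>;
      \<open>\<beta> < beta_bar\<close> rearranges to positivity of \<open>gap\<close>.\<close>
    define y where "y = (case rcv of MRC \<Rightarrow> R | ZF \<Rightarrow> 0)"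
    have y_eq: "(case rcv of MRC \<Rightarrow> \<rho> / r powr \<alpha> | ZF \<Rightarrow> 0) = y"
      by (simp add: y_def R_def split: receiver.split)
    define w where "w = (case rcv of MRC \<Rightarrow> R / \<kappa> | ZF \<Rightarrow> R * (1 / \<kappa> - 1))"
    define gap where "gap = w - \<beta> * (y + 1)"
    have gap: "0 < gap"
    proof (cases rcv)
      case MRC
      have "1 / (\<kappa> * (r powr \<alpha> / \<rho> + 1)) = R / \<kappa> / (R + 1)"
        using pos \<kappa> by (simp add: R_def field_simps)
      then have "\<beta> < R / \<kappa> / (R + 1)"
        using \<beta> MRC by (simp only: beta_bar_def receiver.case)
      then have "\<beta> * (R + 1) < R / \<kappa>"
        using R by (subst (asm) pos_less_divide_eq) auto
      then show ?thesis using MRC by (simp add: gap_def w_def y_def)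
    next
      case ZF
      then show ?thesis using \<beta> by (simp add: gap_def w_def y_def beta_bar_def R_def)
    qed
    \<comment> \<open>One slack serves three purposes: the deviation of \<open>W\<close>, the
      deviation of \<open>Y\<close> and the tolerated interference. The last two are multiplied by
      \<open>\<beta>\<close>, so together they cost \<open>\<delta> * (1 + 2 * \<beta>)\<close>,
      which uses up the gap.\<close>
    define \<delta> where "\<delta> = gap / (1 + 2 * \<beta>)"
    have \<delta>: "0 < \<delta>" using gap pos by (simp add: \<delta>_def)
    have sep0: "\<beta> * (y + \<delta> + 1 + \<delta>) = w - \<delta>"
    proof -
      have "\<delta> * (1 + 2 * \<beta>) = gap" using pos by (simp add: \<delta>_def)
      then show ?thesis by (simp add: gap_def algebra_simps)
    qed
    define K where "K = (\<integral>x. min 1 (\<rho> * norm x powr (- \<alpha>)) \<partial>(lborel :: (real^2) measure))"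
    define L where "L = (1 / \<delta>) powr (2 / \<alpha>) * K / (1 - exp (- 1))"
    have K: "0 < K"
      using shot_exponent_pos[of \<alpha> \<rho> 1] shot_exponent_upper[of \<alpha> \<rho> 1] pos by (simp add: K_def)
    have L: "0 < L" using K \<delta> by (simp add: L_def)
    \<comment> \<open>Deviations of the signal account for less than \<open>\<epsilon> / 2\<close>
      of the outage, and interference above \<open>\<delta>\<close> for at most
      \<open>\<mu> * L\<close>; hence \<open>\<mu>\<close> is at least
      \<open>\<epsilon> / (2 * L)\<close>, and the capacity is
      \<open>\<kappa> * N * \<mu> * (1 - \<epsilon>)\<close>.\<close>
    define \<phi>1 where "\<phi>1 = \<kappa> * (\<epsilon> / (2 * L)) * (1 - \<epsilon>)"
    have \<phi>1: "0 < \<phi>1" using \<kappa> L pos by (simp add: \<phi>1_def)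
    \<comment> \<open>This is the bound of \<open>prob_small_signal\<close> with scale
      \<open>R / (\<kappa> * N)\<close>.\<close>
    have "(\<lambda>N. 2 * (R / (\<kappa> * \<delta>))\<^sup>2 / real N) \<longlonglongrightarrow> 0" by real_asymp
    then have "\<forall>\<^sub>F N in sequentially. 2 * (R / (\<kappa> * \<delta>))\<^sup>2 / real N < \<epsilon> / 2"
      by (rule order_tendstoD) (use pos in simp)
    \<comment> \<open>Halving \<open>\<phi>1\<close> and adding 1 to \<open>\<bar>C\<bar>\<close>
      produce the strict inequalities that \<open>Theta_within\<close> demands.\<close>
    then have ev: "\<forall>\<^sub>F N in sequentially. N \<in> {N. \<kappa> * real N \<in> \<int>} \<longrightarrow>
        \<phi>1 / 2 * real N < c N \<and> c N < (\<bar>C\<bar> + 1) * real N"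
      using eventually_ge_at_top[of 1]
    proof eventually_elim
      case (elim N)
      show ?case
      proof
        assume "N \<in> {N. \<kappa> * real N \<in> \<int>}"
        then have M_eq: "real (M N) = \<kappa> * N" using MN elim by simp
        have N: "1 \<le> N" using elim by simp
        have small: "measure (P N) {\<omega> \<in> space (P N). W N \<omega> \<le> \<beta> * (Y N \<omega> + 1 + \<delta>)} < \<epsilon> / 2"
        proof -
          \<comment> \<open>The event concerns only \<open>W N\<close> and \<open>Y N\<close>, so
            the model at intensity 1 can be used before the solution \<open>\<mu>\<close> is known
            to exist.\<close>
          interpret stream rcv \<alpha> \<rho> r N "M N" 1 "P N" "X N 1" "\<Psi> N 1" "W N" "Y N"
            by (rule stream[OF N]) simp
          have scale: "\<rho> / (M N * r powr \<alpha>) = R / (\<kappa> * N)" by (simp add: R_def M_eq)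
          \<comment> \<open>An equality for MRC; for ZF the additional 1 in the shape
            \<open>N - M N + 1\<close> only raises the mean above its limit.\<close>
          have "w \<le> real (case rcv of MRC \<Rightarrow> N | ZF \<Rightarrow> N - M N + 1) * (R / (\<kappa> * N))"
          proof (cases rcv)
            case MRC
            then show ?thesis using N by (simp add: w_def)
          next
            case ZF
            have "w = (real N - M N) * (R / (\<kappa> * N))"
              using ZF N \<kappa> by (simp add: w_def M_eq field_simps)
            also have "\<dots> \<le> real (N - M N + 1) * (R / (\<kappa> * N))"
              using \<kappa> R streams[OF N] by (intro mult_right_mono) (auto simp: of_nat_diff)
            finally show ?thesis using ZF by simp
          qed
          then have "prob {\<omega> \<in> space (P N). W N \<omega> \<le> \<beta> * (Y N \<omega> + 1 + \<delta>)} \<le>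
              2 * (N * (\<rho> / (M N * r powr \<alpha>))\<^sup>2 / \<delta>\<^sup>2)"
            by (intro prob_small_signal \<open>\<beta> > 0\<close> \<delta>)
              (simp only: scale y_eq sep0)
          also have "\<dots> = 2 * (R / (\<kappa> * \<delta>))\<^sup>2 / N"
            unfolding scale using N by (simp add: power2_eq_square)
          finally show ?thesis using elim by simp
        qed
        have "?P0 N < \<epsilon>"
        proof -
          interpret stream rcv \<alpha> \<rho> r N "M N" 1 "P N" "X N 1" "\<Psi> N 1" "W N" "Y N"
            by (rule stream[OF N]) simp
          show ?thesis
            using prob_noise_le_shift[OF \<open>\<beta> > 0\<close> \<delta>] small \<open>0 < \<epsilon>\<close> by linarith
        qed
        then obtain \<mu> :: real where \<mu>: "0 < \<mu>" "outage_prob (P N) \<alpha> (X N \<mu>) (\<Psi> N \<mu>) (W N) (Y N) \<beta> = \<epsilon>"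
            "c N = real (M N) * \<mu> * (1 - \<epsilon>)" using intensity[OF N] by blast
        interpret stream rcv \<alpha> \<rho> r N "M N" \<mu> "P N" "X N \<mu>" "\<Psi> N \<mu>" "W N" "Y N"
          by (rule stream[OF N \<mu>(1)])
        let ?k = "shot_exponent \<alpha> \<rho> (M N)"
        have "\<epsilon> / 2 \<le> \<mu> * ((1 / \<delta>) powr (2 / \<alpha>) * ?k) / (1 - exp (- 1))"
          using outage_prob_le[OF \<open>\<beta> > 0\<close> \<delta>] small \<mu>(2) by linarith
        also have "\<dots> \<le> \<mu> * ((1 / \<delta>) powr (2 / \<alpha>) * K) / (1 - exp (- 1))"
          unfolding K_def using \<mu> streams[OF N] pos
          by (intro divide_right_mono mult_left_mono shot_exponent_upper) auto
        also have "\<dots> = \<mu> * L" by (simp add: L_def)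
        finally have "\<epsilon> / (2 * L) \<le> \<mu>" using L by (simp add: field_simps)
        then have "\<kappa> * N * (\<epsilon> / (2 * L)) * (1 - \<epsilon>) \<le> \<kappa> * N * \<mu> * (1 - \<epsilon>)"
          using \<kappa> pos by (intro mult_right_mono mult_left_mono) auto
        then have "\<phi>1 * N \<le> c N" by (simp add: \<phi>1_def \<mu>(3) M_eq mult_ac)
        moreover have "\<phi>1 / 2 * N < \<phi>1 * N" using \<phi>1 N by simp
        moreover have "\<bar>C\<bar> * N < (\<bar>C\<bar> + 1) * N" using N by (simp add: distrib_right)
        ultimately show "\<phi>1 / 2 * real N < c N \<and> c N < (\<bar>C\<bar> + 1) * real N"
          using C'[OF N] by linarith
      qed
    qed
    have "0 < \<phi>1 / 2" "0 < \<bar>C\<bar> + 1" using \<phi>1 by auto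
    with ev show ?thesis unfolding Theta_within_def by blast
  qed
  show ?thesis using theta bigo smallo by blast
qed

end
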